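(* Let $(b,0)$ be a graph over the discrete measure space $(X,m)$ and let $L_0$ be a realization associated with a form $(Q_0,D(Q_0))$ over $(b,0)$ such that $D(Q_0)$, equipped with the form norm $\|\cdot\|_{Q_0}$, is compactly embedded in $\ell^2(X,m)$. Let $c\colon X\to[0,\infty)$ and let $L_c$ be the induced realization. Let $f_n^c\in\ell^2(X,m)$, $n=1,\dots,\dim\ell^2(X,m)$, denote corresponding orthogonal and normalized eigenfunctions of $L_c$ to the eigenvalues $\lambda_n(c)$. Then $$\sum_{n=1}^{\dim\ell^2(X,m)}|f_n^c(x)|^2=\frac1{m(x)}\qquad\text{for all }x\in X.$$
   Context: Let $X$ be a non-empty, at most countable set, $b\colon X\times X\to[0,\infty)$ symmetric with $b(x,x)=0$ and $\sum_{y\in X}b(x,y)<\infty$ for all $x\in X$, and let $c\colon X\to[0,\infty)$ and $m\colon X\to(0,\infty)$ be maps; $m$ is extended to a measure on $X$ by $m(A)=\sum_{x\in A}m(x)$. Then $(b,c)$ is called a graph over the discrete measure space $(X,m)$. Let $C(X)$ be the space of real functions on $X$, $C_c(X)$ the subspace of finitely supported functions, and let $\ell^2(X,m)=\{f\in C(X):\sum_{x\in X}|f(x)|^2m(x)<\infty\}$ be the Hilbert space with scalar product $\langle f,g\rangle=\sum_{x\in X}f(x)g(x)m(x)$. Set $\mathcal D_{b,c}=\{f\in C(X):\sum_{x,y\in X}b(x,y)|f(x)-f(y)|^2+\sum_{x\in X}c(x)|f(x)|^2<\infty\}$ and, for $f,g\in\mathcal D_{b,c}$, $$\mathcal Q_{b,c}(f,g)=\tfrac12\sum_{x,y\in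 X}b(x,y)(f(x)-f(y))(g(x)-g(y))+\sum_{x\in X}c(x)f(x)g(x).$$ Realization: let $Q_0$ be the restriction of $\mathcal Q_{b,0}$ to a linear subspace $D(Q_0)\subset \ell^2(X,m)\cap\mathcal D_{b,0}$ with $C_c(X)\subset D(Q_0)$ such that $Q_0$ is closed, i.e. $D(Q_0)$ is complete with respect to the form norm $\|f\|_{Q_0}^2=\|f\|_{\ell^2(X,m)}^2+Q_0(f,f)$. The positive self-adjoint operator $L_0$ in $\ell^2(X,m)$ associated with $Q_0$ via the form representation theorem ($D(L_0)\subset D(Q_0)$ and $Q_0(f,g)=\langle f,L_0g\rangle$ for $f\in D(Q_0)$, $g\in D(L_0)$) is called a realization. Induced realization: given a realization $L_0$ and $c\colon X\to[0,\infty)$, let $Q_c$ be the restriction of $\mathcal Q_{b,c}$ to $$D(Q_c)=D(Q_0)\cap\Big\{f\in\ell^2(X,m):\sum_{x\in X}c(x)|f(x)|^2<\infty\Big\}.$$ The self-adjoint operator $L_c$ in $\ell^2(X,m)$ associated with $Q_c$ is called the induced realization of $c$. Under the compact embedding hypothesis on $D(Q_0)$, $L_c$ has purely discrete spectrum; its eigenvalues $\lambda_n(c)$, $n=1,\dots,\dim\ell^2(X,m)$, are listed in non-decreasing order, counted with multiplicity, and the $f_n^c$ are pairwise orthogonal with norm one and satisfy $L_cf_n^c=\lambda_n(c)f_n^c$. If $X$ is infinite, $\dim\ell^2(X,m)=\infty$ and $n$ ranges over all positive integers. *)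

theory Defs
  imports "HOL-Analysis.Analysis" "HOL-Library.Function_Algebras"
begin

text \<open>
  The vertex set is the universe of a type of class \<open>countable\<close>, i.e. an arbitrary non-empty set
  that is finite or countably infinite. Functions form a real vector space with the pointwise
  operations and the following scaling.
\<close>

definition fscale :: "real \<Rightarrow> ('a \<Rightarrow> real) \<Rightarrow> 'a \<Rightarrow> real" where
  "fscale r f = (\<lambda>x. r * f x)"

lemma vector_space_fscale: "vector_space (fscale :: real \<Rightarrow> ('a \<Rightarrow> real) \<Rightarrow> 'a \<Rightarrow> real)"
  by unfold_locales (auto simp: fscale_def algebra_simps)

definition ecard :: "'b set \<Rightarrow> enat" where
  "ecard A = (if finite A then enat (card A) else \<infinity>)"

text \<open>The constant \<open>vector_space.dim\<close> is a natural number and carries no information about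
  infinite-dimensional spaces, hence the explicit value \<open>\<infinity>\<close> below.\<close>

definition edim :: "('a \<Rightarrow> real) set \<Rightarrow> enat" where
  "edim V = (if \<exists>B. finite B \<and> V \<subseteq> module.span fscale B
             then enat (vector_space.dim fscale V) else \<infinity>)"

definition graph :: "('a \<Rightarrow> 'a \<Rightarrow> real) \<Rightarrow> ('a \<Rightarrow> real) \<Rightarrow> bool" where
  "graph b c \<longleftrightarrow>
     (\<forall>x y. 0 \<le> b x y) \<and> (\<forall>x y. b x y = b y x) \<and> (\<forall>x. b x x = 0) \<and>
     (\<forall>x. (\<lambda>y. b x y) summable_on UNIV) \<and> (\<forall>x. 0 \<le> c x)"

definition finsupp :: "('a \<Rightarrow> real) set" where
  "finsupp = {f. finite {x. f x \<noteq> 0}}"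

definition l2 :: "('a \<Rightarrow> real) \<Rightarrow> ('a \<Rightarrow> real) set" where
  "l2 m = {f. (\<lambda>x. \<bar>f x\<bar>\<^sup>2 * m x) summable_on UNIV}"

definition l2_inner :: "('a \<Rightarrow> real) \<Rightarrow> ('a \<Rightarrow> real) \<Rightarrow> ('a \<Rightarrow> real) \<Rightarrow> real" where
  "l2_inner m f g = (\<Sum>\<^sub>\<infinity>x. f x * g x * m x)"

definition l2_norm :: "('a \<Rightarrow> real) \<Rightarrow> ('a \<Rightarrow> real) \<Rightarrow> real" where
  "l2_norm m f = sqrt (l2_inner m f f)"

definition l2_dist :: "('a \<Rightarrow> real) \<Rightarrow> ('a \<Rightarrow> real) \<Rightarrow> ('a \<Rightarrow> real) \<Rightarrow> real" where
  "l2_dist m f g = l2_norm m (f - g)"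

definition energy_space :: "('a \<Rightarrow> 'a \<Rightarrow> real) \<Rightarrow> ('a \<Rightarrow> real) \<Rightarrow> ('a \<Rightarrow> real) set" where
  "energy_space b c =
     {f. (\<lambda>(x, y). b x y * \<bar>f x - f y\<bar>\<^sup>2) summable_on UNIV \<and>
         (\<lambda>x. c x * \<bar>f x\<bar>\<^sup>2) summable_on UNIV}"

definition energy_form ::
    "('a \<Rightarrow> 'a \<Rightarrow> real) \<Rightarrow> ('a \<Rightarrow> real) \<Rightarrow> ('a \<Rightarrow> real) \<Rightarrow> ('a \<Rightarrow> real) \<Rightarrow> real" where
  "energy_form b c f g =
     1 / 2 * (\<Sum>\<^sub>\<infinity>(x, y). b x y * (f x - f y) * (g x - g y)) + (\<Sum>\<^sub>\<infinity>x. c x * f x * g x)"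

text \<open>A form is given by a function \<open>Q\<close> of two arguments and a domain \<open>D\<close>; only the values of
  \<open>Q\<close> on \<open>D\<close> matter. Likewise an operator is a map \<open>L\<close> together with a domain \<open>DL\<close>.\<close>

definition form_norm ::
    "('a \<Rightarrow> real) \<Rightarrow> (('a \<Rightarrow> real) \<Rightarrow> ('a \<Rightarrow> real) \<Rightarrow> real) \<Rightarrow> ('a \<Rightarrow> real) \<Rightarrow> real" where
  "form_norm m Q f = sqrt ((l2_norm m f)\<^sup>2 + Q f f)"

definition form_dist ::
    "('a \<Rightarrow> real) \<Rightarrow> (('a \<Rightarrow> real) \<Rightarrow> ('a \<Rightarrow> real) \<Rightarrow> real) \<Rightarrow> ('a \<Rightarrow> real) \<Rightarrow> ('a \<Rightarrow> real) \<Rightarrow> real" where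
  "form_dist m Q f g = form_norm m Q (f - g)"

definition closed_form ::
    "('a \<Rightarrow> real) \<Rightarrow> (('a \<Rightarrow> real) \<Rightarrow> ('a \<Rightarrow> real) \<Rightarrow> real) \<Rightarrow> ('a \<Rightarrow> real) set \<Rightarrow> bool" where
  "closed_form m Q D \<longleftrightarrow> Metric_space.mcomplete D (form_dist m Q)"

definition compactly_embedded ::
    "('a \<Rightarrow> real) \<Rightarrow> (('a \<Rightarrow> real) \<Rightarrow> ('a \<Rightarrow> real) \<Rightarrow> real) \<Rightarrow> ('a \<Rightarrow> real) set \<Rightarrow> bool" where
  "compactly_embedded m Q D \<longleftrightarrow>
     (\<forall>S \<subseteq> D. Metric_space.mbounded D (form_dist m Q) S \<longrightarrow>
        compactin (Metric_space.mtopology (l2 m) (l2_dist m))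
          (Metric_space.mtopology (l2 m) (l2_dist m) closure_of S))"

definition densely_defined_linear ::
    "('a \<Rightarrow> real) \<Rightarrow> ('a \<Rightarrow> real) set \<Rightarrow> (('a \<Rightarrow> real) \<Rightarrow> 'a \<Rightarrow> real) \<Rightarrow> bool" where
  "densely_defined_linear m DL L \<longleftrightarrow>
     DL \<subseteq> l2 m \<and> module.subspace fscale DL \<and>
     Metric_space.mtopology (l2 m) (l2_dist m) closure_of DL = l2 m \<and>
     L ` DL \<subseteq> l2 m \<and>
     (\<forall>f\<in>DL. \<forall>g\<in>DL. L (f + g) = L f + L g) \<and>
     (\<forall>r. \<forall>f\<in>DL. L (fscale r f) = fscale r (L f))"

definition adjoint_domain ::
    "('a \<Rightarrow> real) \<Rightarrow> ('a \<Rightarrow> real) set \<Rightarrow> (('a \<Rightarrow> real) \<Rightarrow> 'a \<Rightarrow> real) \<Rightarrow> ('a \<Rightarrow> real) set" where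
  "adjoint_domain m DL L =
     {g \<in> l2 m. \<exists>k\<in>l2 m. \<forall>f\<in>DL. l2_inner m (L f) g = l2_inner m f k}"

text \<open>Symmetry says that \<open>L\<close> is a restriction of its adjoint; equality of the domains then
  says that \<open>L\<close> equals its adjoint.\<close>

definition self_adjoint ::
    "('a \<Rightarrow> real) \<Rightarrow> ('a \<Rightarrow> real) set \<Rightarrow> (('a \<Rightarrow> real) \<Rightarrow> 'a \<Rightarrow> real) \<Rightarrow> bool" where
  "self_adjoint m DL L \<longleftrightarrow>
     densely_defined_linear m DL L \<and>
     (\<forall>f\<in>DL. \<forall>g\<in>DL. l2_inner m (L f) g = l2_inner m f (L g)) \<and>
     adjoint_domain m DL L = DL"

text \<open>The properties below determine \<open>DL\<close> and \<open>L\<close> on \<open>DL\<close> uniquely, since a self-adjoint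
  operator has no proper symmetric extension.\<close>

definition associated_operator ::
    "('a \<Rightarrow> real) \<Rightarrow> (('a \<Rightarrow> real) \<Rightarrow> ('a \<Rightarrow> real) \<Rightarrow> real) \<Rightarrow> ('a \<Rightarrow> real) set \<Rightarrow>
     ('a \<Rightarrow> real) set \<Rightarrow> (('a \<Rightarrow> real) \<Rightarrow> 'a \<Rightarrow> real) \<Rightarrow> bool" where
  "associated_operator m Q D DL L \<longleftrightarrow>
     self_adjoint m DL L \<and> (\<forall>f\<in>DL. 0 \<le> l2_inner m f (L f)) \<and>
     DL \<subseteq> D \<and> (\<forall>f\<in>D. \<forall>g\<in>DL. Q f g = l2_inner m f (L g))"

definition realization ::
    "('a \<Rightarrow> real) \<Rightarrow> ('a \<Rightarrow> 'a \<Rightarrow> real) \<Rightarrow> ('a \<Rightarrow> real) set \<Rightarrow>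
     ('a \<Rightarrow> real) set \<Rightarrow> (('a \<Rightarrow> real) \<Rightarrow> 'a \<Rightarrow> real) \<Rightarrow> bool" where
  "realization m b D0 DL0 L0 \<longleftrightarrow>
     module.subspace fscale D0 \<and> D0 \<subseteq> l2 m \<inter> energy_space b (\<lambda>_. 0) \<and> finsupp \<subseteq> D0 \<and>
     closed_form m (energy_form b (\<lambda>_. 0)) D0 \<and>
     associated_operator m (energy_form b (\<lambda>_. 0)) D0 DL0 L0"

definition induced_domain ::
    "('a \<Rightarrow> real) \<Rightarrow> ('a \<Rightarrow> real) set \<Rightarrow> ('a \<Rightarrow> real) \<Rightarrow> ('a \<Rightarrow> real) set" where
  "induced_domain m D0 c = D0 \<inter> {f \<in> l2 m. (\<lambda>x. c x * \<bar>f x\<bar>\<^sup>2) summable_on UNIV}"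

definition induced_realization ::
    "('a \<Rightarrow> real) \<Rightarrow> ('a \<Rightarrow> 'a \<Rightarrow> real) \<Rightarrow> ('a \<Rightarrow> real) set \<Rightarrow> ('a \<Rightarrow> real) \<Rightarrow>
     ('a \<Rightarrow> real) set \<Rightarrow> (('a \<Rightarrow> real) \<Rightarrow> 'a \<Rightarrow> real) \<Rightarrow> bool" where
  "induced_realization m b D0 c DL L \<longleftrightarrow>
     associated_operator m (energy_form b c) (induced_domain m D0 c) DL L"

definition eigenspace ::
    "('a \<Rightarrow> real) set \<Rightarrow> (('a \<Rightarrow> real) \<Rightarrow> 'a \<Rightarrow> real) \<Rightarrow> real \<Rightarrow> ('a \<Rightarrow> real) set" where
  "eigenspace DL L \<mu> = {f \<in> DL. L f = fscale \<mu> f}"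

definition indices :: "enat \<Rightarrow> nat set" where
  "indices N = {n. 1 \<le> n \<and> enat n \<le> N}"

text \<open>\<open>lam\<close>, restricted to the positive integers up to \<open>N\<close>, lists the eigenvalues of \<open>L\<close> in
  non-decreasing order: every real \<open>\<mu>\<close> occurs exactly as often as the dimension of its
  eigenspace, so in particular not at all if it is no eigenvalue.\<close>

definition lists_eigenvalues ::
    "('a \<Rightarrow> real) set \<Rightarrow> (('a \<Rightarrow> real) \<Rightarrow> 'a \<Rightarrow> real) \<Rightarrow> enat \<Rightarrow> (nat \<Rightarrow> real) \<Rightarrow> bool" where
  "lists_eigenvalues DL L N lam \<longleftrightarrow>
     mono_on (indices N) lam \<and>
     (\<forall>\<mu>. ecard {n \<in> indices N. lam n = \<mu>} = edim (eigenspace DL L \<mu>))"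

definition orthonormal_on :: "('a \<Rightarrow> real) \<Rightarrow> nat set \<Rightarrow> (nat \<Rightarrow> 'a \<Rightarrow> real) \<Rightarrow> bool" where
  "orthonormal_on m I f \<longleftrightarrow>
     (\<forall>n\<in>I. f n \<in> l2 m \<and> l2_norm m (f n) = 1) \<and>
     (\<forall>n\<in>I. \<forall>k\<in>I. n \<noteq> k \<longrightarrow> l2_inner m (f n) (f k) = 0)"

end

theory Submission
  imports Defs
begin

text \<open>
  Apply Parseval's identity to the indicator of \<open>x\<close>, which lies in \<open>D(Q\<^sub>c)\<close>. The form \<open>Q\<^sub>c\<close> is
  closed on its domain by Fatou's lemma, so the orthogonal projection onto the closed span of the
  \<open>f\<^sub>n\<close> preserves \<open>D(Q\<^sub>c)\<close> and commutes with \<open>Q\<^sub>c\<close>. If Parseval's identity failed, the orthogonal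
  complement of the \<open>f\<^sub>n\<close> in \<open>D(Q\<^sub>c)\<close> would be nonzero; by the compact embedding the Rayleigh quotient
  attains its minimum \<open>\<mu>\<close> there, at some \<open>u\<close>. Self-adjointness makes \<open>u\<close> an eigenfunction of \<open>L\<^sub>c\<close>
  orthogonal to all \<open>f\<^sub>n\<close>. Since only finitely many \<open>f\<^sub>n\<close> belong to \<open>\<mu>\<close>, again by compactness, this
  contradicts the multiplicity of \<open>\<mu>\<close> in the list of eigenvalues.
\<close>

section \<open>Semi-inner products on function spaces\<close>

interpretation fs: vector_space fscale
  by (rule vector_space_fscale)

lemma fscale_apply [simp]: "fscale r f x = r * f x"
  by (simp add: fscale_def)

text \<open>Definiteness is left out on purpose: an energy form with \<open>c = 0\<close> vanishes
  on constants, and the shifted form behind the eigenvalue equation vanishes at the minimizer. The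
  carrier is explicit because the forms live on different subspaces of one function type.\<close>

locale semi_inner =
  fixes V :: "('a \<Rightarrow> real) set" and B :: "('a \<Rightarrow> real) \<Rightarrow> ('a \<Rightarrow> real) \<Rightarrow> real"
  assumes subspace: "module.subspace fscale V"
    and sym: "f \<in> V \<Longrightarrow> g \<in> V \<Longrightarrow> B f g = B g f"
    and add_left: "f \<in> V \<Longrightarrow> g \<in> V \<Longrightarrow> h \<in> V \<Longrightarrow> B (f + g) h = B f h + B g h"
    and scale_left: "f \<in> V \<Longrightarrow> g \<in> V \<Longrightarrow> B (fscale r f) g = r * B f g"
    and nonneg: "f \<in> V \<Longrightarrow> 0 \<le> B f f"
begin

lemma mem_intros [intro, simp]:
  "0 \<in> V"
  "f \<in> V \<Longrightarrow> g \<in> V \<Longrightarrow> f + g \<in> V"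
  "f \<in> V \<Longrightarrow> g \<in> V \<Longrightarrow> f - g \<in> V"
  "f \<in> V \<Longrightarrow> fscale r f \<in> V"
  using subspace by (auto intro: fs.subspace_0 fs.subspace_add fs.subspace_diff fs.subspace_scale)

lemma sum_mem [intro]: "(\<And>i. i \<in> A \<Longrightarrow> f i \<in> V) \<Longrightarrow> sum f A \<in> V"
  using subspace by (rule fs.subspace_sum)

lemma add_right: "f \<in> V \<Longrightarrow> g \<in> V \<Longrightarrow> h \<in> V \<Longrightarrow> B h (f + g) = B h f + B h g"
  using add_left[of f g h] sym[of h] by simp

lemma scale_right: "f \<in> V \<Longrightarrow> g \<in> V \<Longrightarrow> B g (fscale r f) = r * B g f"
  using scale_left[of f g r] sym[of g] by simp

lemma diff_left: "f \<in> V \<Longrightarrow> g \<in> V \<Longrightarrow> h \<in> V \<Longrightarrow> B (f - g) h = B f h - B g h"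
  using add_left[of "f - g" g h] by simp

lemma diff_right: "f \<in> V \<Longrightarrow> g \<in> V \<Longrightarrow> h \<in> V \<Longrightarrow> B h (f - g) = B h f - B h g"
  using add_right[of "f - g" g h] by simp

lemma zero_left: "g \<in> V \<Longrightarrow> B 0 g = 0"
  using diff_left[of g g g] by simp

lemma sum_left: "(\<And>i. i \<in> A \<Longrightarrow> f i \<in> V) \<Longrightarrow> g \<in> V \<Longrightarrow> B (sum f A) g = (\<Sum>i\<in>A. B (f i) g)"
proof (induction A rule: infinite_finite_induct)
  case (insert x F)
  then have "f x \<in> V" "sum f F \<in> V"
    by auto
  with insert show ?case
    by (simp only: sum.insert add_left insert_iff simp_thms)
qed (simp_all add: zero_left)

lemma sum_right: "(\<And>i. i \<in> A \<Longrightarrow> f i \<in> V) \<Longrightarrow> g \<in> V \<Longrightarrow> B g (sum f A) = (\<Sum>i\<in>A. B g (f i))"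
  using sum_left[of A f g] sym[of g] by (simp add: sum_mem)

lemmas bilinear = add_left add_right diff_left diff_right scale_left scale_right

lemma diff_swap:
  assumes "f \<in> V" "g \<in> V"
  shows "B (f - g) (f - g) = B (g - f) (g - f)"
  using assms sym[of f g] by (simp add: bilinear)

text \<open>A quadratic polynomial in \<open>t\<close> without negative values has no positive
  discriminant. The leading coefficient \<open>B g g\<close> may vanish even for nonzero
  \<open>g\<close>, hence the case distinction.\<close>

lemma Cauchy_Schwarz:
  assumes f: "f \<in> V" and g: "g \<in> V"
  shows "(B f g)\<^sup>2 \<le> B f f * B g g"
proof -
  have *: "0 \<le> B f f + 2 * t * B f g + t\<^sup>2 * B g g" for t
    using nonneg[of "f + fscale t g"] f g sym[of g f]
    by (simp add: bilinear algebra_simps power2_eq_square)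
  show ?thesis
  proof (cases "B g g = 0")
    case True
    have "B f g = 0"
    proof (rule ccontr)
      assume "B f g \<noteq> 0"
      \<comment> \<open>With \<open>B g g = 0\<close> the polynomial is affine in \<open>t\<close>;
        the chosen \<open>t\<close> gives it the value \<open>-1\<close>.\<close>
      then show False
        using *[of "- (B f f + 1) / (2 * B f g)"] True nonneg[OF f] by (simp add: field_simps)
    qed
    with True show ?thesis by simp
  next
    case False
    with nonneg[OF g] have pos: "B g g > 0" by simp
    have "0 \<le> B f f - (B f g)\<^sup>2 / B g g"
      using *[of "- (B f g) / B g g"] pos by (simp add: power2_eq_square field_simps)
    with pos show ?thesis by (simp add: field_simps)
  qed
qed

lemma abs_le_sqrt:
  assumes "f \<in> V" "g \<in> V"
  shows "\<bar>B f g\<bar> \<le> sqrt (B f f) * sqrt (B g g)"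
  using real_sqrt_le_mono[OF Cauchy_Schwarz[OF assms]] by (simp add: real_sqrt_mult)

lemma triangle:
  assumes f: "f \<in> V" and g: "g \<in> V"
  shows "sqrt (B (f + g) (f + g)) \<le> sqrt (B f f) + sqrt (B g g)"
proof (rule real_le_lsqrt)
  have "B (f + g) (f + g) = B f f + 2 * B f g + B g g"
    using f g sym[of g f] by (simp add: bilinear)
  also have "\<dots> \<le> B f f + 2 * (sqrt (B f f) * sqrt (B g g)) + B g g"
    using abs_le_sqrt[OF f g] by linarith
  also have "\<dots> = (sqrt (B f f) + sqrt (B g g))\<^sup>2"
    using nonneg[OF f] nonneg[OF g] by (simp add: power2_sum)
  finally show "B (f + g) (f + g) \<le> (sqrt (B f f) + sqrt (B g g))\<^sup>2" .
qed (use nonneg[OF f] nonneg[OF g] in simp)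


text \<open>Nonnegativity and invariance under negation are required of all functions, since the
  corresponding axioms of \<open>Metric_space\<close> are not restricted to the carrier.\<close>

lemma Metric_space_sqrt:
  assumes nonneg_all: "\<And>f. 0 \<le> B f f" and uminus: "\<And>f. B (- f) (- f) = B f f"
    and definite: "\<And>f. f \<in> V \<Longrightarrow> B f f = 0 \<Longrightarrow> f = 0"
  shows "Metric_space V (\<lambda>f g. sqrt (B (f - g) (f - g)))"
proof
  show "sqrt (B (f - g) (f - g)) = sqrt (B (g - f) (g - f))" for f g
    using uminus[of "f - g"] by simp
  show "(sqrt (B (f - g) (f - g)) = 0) = (f = g)" if "f \<in> V" "g \<in> V" for f g
    using definite[of "f - g"] that zero_left by auto
  show "sqrt (B (f - h) (f - h)) \<le> sqrt (B (f - g) (f - g)) + sqrt (B (g - h) (g - h))"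
    if "f \<in> V" "g \<in> V" "h \<in> V" for f g h
    using triangle[of "f - g" "g - h"] that by simp
qed (simp add: nonneg_all)

text \<open>By Cauchy-Schwarz, pairing with a fixed \<open>g\<close> is continuous for the seminorm
  of \<open>B\<close>.\<close>

lemma tendsto_left:
  assumes u: "\<And>k. u k \<in> V" and l: "l \<in> V" and g: "g \<in> V"
    and lim: "(\<lambda>k. B (u k - l) (u k - l)) \<longlonglongrightarrow> 0"
  shows "(\<lambda>k. B (u k) g) \<longlonglongrightarrow> B l g"
proof -
  have "(\<lambda>k. sqrt (B (u k - l) (u k - l)) * sqrt (B g g)) \<longlonglongrightarrow> sqrt 0 * sqrt (B g g)"
    by (intro tendsto_intros lim)
  then have "(\<lambda>k. B (u k - l) g) \<longlonglongrightarrow> 0"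
    using abs_le_sqrt[of "u _ - l" g] u l g by (intro Lim_null_comparison[of "\<lambda>k. B (u k - l) g"]) auto
  then show ?thesis
    using u l g by (simp add: diff_left LIM_zero_iff)
qed

lemma tendsto_self:
  assumes u: "\<And>k. u k \<in> V" and l: "l \<in> V"
    and lim: "(\<lambda>k. B (u k - l) (u k - l)) \<longlonglongrightarrow> 0"
  shows "(\<lambda>k. B (u k) (u k)) \<longlonglongrightarrow> B l l"
proof -
  have "B (u k) (u k) = B (u k - l) (u k - l) + 2 * B (u k) l - B l l" for k
    using u l sym[of l "u k"] by (simp add: bilinear)
  moreover have "(\<lambda>k. B (u k - l) (u k - l) + 2 * B (u k) l - B l l) \<longlonglongrightarrow> 0 + 2 * B l l - B l l"
    by (intro tendsto_intros lim tendsto_left u l)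
  ultimately show ?thesis by simp
qed

text \<open>Pairing a vanishing linear combination with one of its vectors isolates the coefficient
  of that vector.\<close>

lemma independent_orthogonal:
  assumes A: "A \<subseteq> V" and pos: "\<And>v. v \<in> A \<Longrightarrow> B v v \<noteq> 0"
    and orth: "\<And>v w. v \<in> A \<Longrightarrow> w \<in> A \<Longrightarrow> v \<noteq> w \<Longrightarrow> B v w = 0"
  shows "\<not> module.dependent fscale A"
proof
  assume "module.dependent fscale A"
  then obtain t a v where t: "finite t" "t \<subseteq> A" "(\<Sum>v\<in>t. fscale (a v) v) = 0" "v \<in> t" "a v \<noteq> 0"
    by (auto simp: fs.dependent_explicit)
  have tV: "w \<in> V" if "w \<in> t" for w
    using t(2) A that by auto
  have "0 = B (\<Sum>w\<in>t. fscale (a w) w) v"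
    using t(3) tV[OF t(4)] zero_left by simp
  also have "\<dots> = (\<Sum>w\<in>t. a w * B w v)"
    using tV t(4) by (simp add: sum_left scale_left)
  also have "\<dots> = (\<Sum>w\<in>t. if w = v then a v * B v v else 0)"
    using t(2,4) orth by (intro sum.cong) auto
  also have "\<dots> = a v * B v v"
    using t(1,4) by simp
  finally show False
    using t pos[of v] by auto
qed

end

lemma semi_inner_subspace:
  assumes "semi_inner V B" "module.subspace fscale W" "W \<subseteq> V"
  shows "semi_inner W B"
  using assms unfolding semi_inner_def by (meson subsetD)

text \<open>The energy form arises with \<open>r = 1 / 2\<close> from its edge part and its vertex
  part, the square of the form norm with \<open>r = 1\<close>.\<close>

lemma semi_inner_combine:
  assumes V: "semi_inner V B" and W: "semi_inner W C" and "0 \<le> r"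
  shows "semi_inner (V \<inter> W) (\<lambda>f g. r * B f g + C f g)"
proof -
  interpret V: semi_inner V B by fact
  interpret W: semi_inner W C by fact
  show ?thesis
  proof
    show "fs.subspace (V \<inter> W)"
      using V.subspace W.subspace by (rule fs.subspace_inter)
    show "r * B f g + C f g = r * B g f + C g f" if "f \<in> V \<inter> W" "g \<in> V \<inter> W" for f g
      using that V.sym[of f g] W.sym[of f g] by simp
  qed (use assms(3) in \<open>auto simp: V.bilinear W.bilinear V.nonneg W.nonneg algebra_simps\<close>)
qed

lemma semi_inner_pullback:
  fixes T :: "('a \<Rightarrow> real) \<Rightarrow> 'b \<Rightarrow> real"
  assumes V: "semi_inner V B" and add: "\<And>f g. T (f + g) = T f + T g"
    and scale: "\<And>r f. T (fscale r f) = fscale r (T f)"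
  shows "semi_inner (T -` V) (\<lambda>f g. B (T f) (T g))"
proof -
  interpret V: semi_inner V B by fact
  have "T 0 = 0"
    using add[of 0 0] by simp
  then show ?thesis
    by unfold_locales (auto simp: fs.subspace_def add scale V.bilinear V.nonneg intro: V.sym)
qed

section \<open>Weighted square-summable functions\<close>

definition wl2 :: "('i \<Rightarrow> real) \<Rightarrow> ('i \<Rightarrow> real) set" where
  "wl2 w = {u. (\<lambda>i. w i * (u i)\<^sup>2) summable_on UNIV}"

definition wl2_inner :: "('i \<Rightarrow> real) \<Rightarrow> ('i \<Rightarrow> real) \<Rightarrow> ('i \<Rightarrow> real) \<Rightarrow> real" where
  "wl2_inner w u v = (\<Sum>\<^sub>\<infinity>i. w i * u i * v i)"

text \<open>Comparison with the two squares, by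
  \<open>\<bar>u i * v i\<bar> \<le> (u i)\<^sup>2 + (v i)\<^sup>2\<close>.\<close>

lemma wl2_mult_summable:
  assumes w: "\<And>i. 0 \<le> w i" and u: "u \<in> wl2 w" and v: "v \<in> wl2 w"
  shows "(\<lambda>i. w i * u i * v i) summable_on UNIV"
proof -
  have "(\<lambda>i. w i * (u i)\<^sup>2 + w i * (v i)\<^sup>2) summable_on UNIV"
    using u v unfolding wl2_def by (intro summable_on_add) auto
  moreover have "norm (w i * u i * v i) \<le> w i * (u i)\<^sup>2 + w i * (v i)\<^sup>2" for i
  proof -
    have "\<bar>u i * v i\<bar> \<le> (u i)\<^sup>2 + (v i)\<^sup>2"
      using sum_squares_bound[of "\<bar>u i\<bar>" "\<bar>v i\<bar>"] abs_ge_zero[of "u i * v i"]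
      unfolding abs_mult power2_abs by linarith
    from mult_left_mono[OF this w[of i]] show ?thesis
      using w[of i] by (simp add: abs_mult algebra_simps)
  qed
  ultimately show ?thesis
    by (rule abs_summable_summable[OF Infinite_Sum.abs_summable_on_comparison_test'])
qed

lemma semi_inner_wl2:
  assumes w: "\<And>i. 0 \<le> w i"
  shows "semi_inner (wl2 w) (wl2_inner w)"
proof
  have add: "f + g \<in> wl2 w" if "f \<in> wl2 w" "g \<in> wl2 w" for f g
  proof -
    have "(\<lambda>i. w i * (f i)\<^sup>2 + 2 * (w i * f i * g i) + w i * (g i)\<^sup>2) summable_on UNIV"
      using that wl2_mult_summable[OF w that] unfolding wl2_def
      by (intro summable_on_add summable_on_cmult_right) auto
    then show ?thesis
      unfolding wl2_def by (simp add: power2_sum algebra_simps)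
  qed
  have scale: "fscale r f \<in> wl2 w" if "f \<in> wl2 w" for r f
    using summable_on_cmult_right[of "\<lambda>i. w i * (f i)\<^sup>2" UNIV "r\<^sup>2"] that
    unfolding wl2_def by (simp add: power_mult_distrib algebra_simps)
  show "fs.subspace (wl2 w)"
    by (auto simp: fs.subspace_def add scale) (simp add: wl2_def)
  show "wl2_inner w f g = wl2_inner w g f" for f g
    unfolding wl2_inner_def by (simp add: mult.commute mult.left_commute)
  show "wl2_inner w (f + g) h = wl2_inner w f h + wl2_inner w g h"
    if "f \<in> wl2 w" "g \<in> wl2 w" "h \<in> wl2 w" for f g h
    using that unfolding wl2_inner_def
    by (simp add: infsum_add[symmetric] wl2_mult_summable[OF w] distrib_left distrib_right)
  show "wl2_inner w (fscale r f) g = r * wl2_inner w f g" for r f g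
    unfolding wl2_inner_def by (simp flip: infsum_cmult_right' add: algebra_simps)
  show "0 \<le> wl2_inner w f f" for f
    unfolding wl2_inner_def by (intro infsum_nonneg) (simp add: w mult.assoc)
qed

lemma wl2_inner_self: "wl2_inner w u u = (\<Sum>\<^sub>\<infinity>i. w i * (u i)\<^sup>2)"
  by (simp add: wl2_inner_def power2_eq_square mult.assoc)

lemma wl2_inner_ge_term:
  assumes w: "\<And>i. 0 \<le> w i" and u: "u \<in> wl2 w"
  shows "w i * (u i)\<^sup>2 \<le> wl2_inner w u u"
  using finite_sum_le_infsum[of "\<lambda>i. w i * (u i)\<^sup>2" UNIV "{i}"] u w
  by (simp add: wl2_inner_self wl2_def)

text \<open>The bound holds for every finite partial sum, survives the pointwise limit there, and is
  uniform in the finite set.\<close>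

lemma wl2_Fatou:
  assumes w: "\<And>i. 0 \<le> w i" and u: "\<And>k. u k \<in> wl2 w"
    and bound: "eventually (\<lambda>k. wl2_inner w (u k) (u k) \<le> C) sequentially"
    and lim: "\<And>i. (\<lambda>k. u k i) \<longlonglongrightarrow> v i"
  shows "v \<in> wl2 w" "wl2_inner w v v \<le> C"
proof -
  have fin: "(\<Sum>i\<in>F. w i * (v i)\<^sup>2) \<le> C" if "finite F" for F
  proof (rule tendsto_le[OF _ tendsto_const])
    show "(\<lambda>k. \<Sum>i\<in>F. w i * (u k i)\<^sup>2) \<longlonglongrightarrow> (\<Sum>i\<in>F. w i * (v i)\<^sup>2)"
      by (intro tendsto_intros lim)
    show "eventually (\<lambda>k. (\<Sum>i\<in>F. w i * (u k i)\<^sup>2) \<le> C) sequentially"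
      using bound
    proof eventually_elim
      case (elim k)
      have "(\<Sum>i\<in>F. w i * (u k i)\<^sup>2) \<le> wl2_inner w (u k) (u k)"
        unfolding wl2_inner_self using u w that
        by (intro finite_sum_le_infsum) (auto simp: wl2_def)
      with elim show ?case by simp
    qed
  qed simp
  show v: "v \<in> wl2 w"
    unfolding wl2_def mem_Collect_eq
    by (rule nonneg_bdd_above_summable_on) (auto intro!: bdd_aboveI2[where M = C] fin simp: w)
  then show "wl2_inner w v v \<le> C"
    unfolding wl2_inner_self wl2_def by (intro infsum_le_finite_sums fin) auto
qed

section \<open>Forms with compact embedding\<close>

text \<open>The Cauchy property for the seminorm of \<open>B\<close>, written with squared distances
  to avoid square roots.\<close>

definition form_Cauchy ::
    "(('a \<Rightarrow> real) \<Rightarrow> ('a \<Rightarrow> real) \<Rightarrow> real) \<Rightarrow> (nat \<Rightarrow> 'a \<Rightarrow> real) \<Rightarrow> bool" where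
  "form_Cauchy B u \<longleftrightarrow> (\<forall>e>0. \<exists>K. \<forall>k\<ge>K. \<forall>l\<ge>K. B (u k - u l) (u k - u l) < e)"

text \<open>Compactness only asks for an \<open>ip\<close>-Cauchy subsequence. A limit inside
  \<open>D\<close> is obtained from \<open>complete\<close> once the subsequence is Cauchy for
  \<open>Q\<close> as well.\<close>

locale compact_form = H: semi_inner D ip + Q: semi_inner D Q
  for D :: "('a \<Rightarrow> real) set" and ip Q +
  assumes complete: "\<And>u. range u \<subseteq> D \<Longrightarrow> form_Cauchy (\<lambda>f g. ip f g + Q f g) u \<Longrightarrow>
      \<exists>l\<in>D. (\<lambda>k. ip (u k - l) (u k - l) + Q (u k - l) (u k - l)) \<longlonglongrightarrow> 0"
    and compact: "\<And>(u :: nat \<Rightarrow> 'a \<Rightarrow> real) C. range u \<subseteq> D \<Longrightarrow> (\<And>k. ip (u k) (u k) + Q (u k) (u k) \<le> C) \<Longrightarrow>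
      \<exists>r. strict_mono r \<and> form_Cauchy ip (u \<circ> r)"
begin

text \<open>Both forms are nonnegative, so convergence for their sum forces convergence for
  each.\<close>

lemma limit:
  assumes u: "range u \<subseteq> D" and "form_Cauchy ip u" "form_Cauchy Q u"
  obtains l where "l \<in> D" "(\<lambda>k. ip (u k - l) (u k - l)) \<longlonglongrightarrow> 0" "(\<lambda>k. Q (u k - l) (u k - l)) \<longlonglongrightarrow> 0"
proof -
  have "form_Cauchy (\<lambda>f g. ip f g + Q f g) u"
    unfolding form_Cauchy_def
  proof (intro allI impI)
    fix e :: real assume "e > 0"
    then obtain K M where
      K: "\<And>k l. k \<ge> K \<Longrightarrow> l \<ge> K \<Longrightarrow> ip (u k - u l) (u k - u l) < e / 2" and
      M: "\<And>k l. k \<ge> M \<Longrightarrow> l \<ge> M \<Longrightarrow> Q (u k - u l) (u k - u l) < e / 2"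
      using assms(2,3) unfolding form_Cauchy_def by (metis half_gt_zero)
    have "ip (u k - u l) (u k - u l) + Q (u k - u l) (u k - u l) < e"
      if "k \<ge> max K M" "l \<ge> max K M" for k l
      using K[of k l] M[of k l] that by simp
    then show "\<exists>K. \<forall>k\<ge>K. \<forall>l\<ge>K. ip (u k - u l) (u k - u l) + Q (u k - u l) (u k - u l) < e"
      by blast
  qed
  from complete[OF u this] obtain l where l: "l \<in> D"
    and lim: "(\<lambda>k. ip (u k - l) (u k - l) + Q (u k - l) (u k - l)) \<longlonglongrightarrow> 0"
    by blast
  have mem: "u k - l \<in> D" for k
    using u l by auto
  have "(\<lambda>k. ip (u k - l) (u k - l)) \<longlonglongrightarrow> 0"
    using H.nonneg[OF mem] Q.nonneg[OF mem]
    by (intro tendsto_sandwich[OF _ _ tendsto_const lim] always_eventually allI) auto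
  moreover have "(\<lambda>k. Q (u k - l) (u k - l)) \<longlonglongrightarrow> 0"
    using H.nonneg[OF mem] Q.nonneg[OF mem]
    by (intro tendsto_sandwich[OF _ _ tendsto_const lim] always_eventually allI) auto
  ultimately show thesis
    using l that by blast
qed

text \<open>Minimising sequences of the Rayleigh quotient have a subsequence that is Cauchy for \<open>ip\<close>;
  the parallelogram identity makes it Cauchy for \<open>Q\<close>, too.\<close>

lemma minimizer_exists:
  assumes V: "module.subspace fscale V" "V \<subseteq> D"
    and closed: "\<And>u l. range u \<subseteq> V \<Longrightarrow> l \<in> D \<Longrightarrow> (\<lambda>k. ip (u k - l) (u k - l)) \<longlonglongrightarrow> 0 \<Longrightarrow> l \<in> V"
    and w: "w \<in> V" "ip w w \<noteq> 0"
  shows "\<exists>u\<in>V. ip u u = 1 \<and> (\<forall>v\<in>V. Q u u * ip v v \<le> Q v v)"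
proof -
  interpret HV: semi_inner V ip
    using H.semi_inner_axioms V by (rule semi_inner_subspace)
  interpret QV: semi_inner V Q
    using Q.semi_inner_axioms V by (rule semi_inner_subspace)
  define S where "S = {Q v v |v. v \<in> V \<and> ip v v = 1}"
  define \<mu> where "\<mu> = Inf S"
  \<comment> \<open>Homogeneity reduces the Rayleigh quotient to unit vectors, over which the
    infimum \<open>\<mu>\<close> is taken.\<close>
  have normalize: "\<exists>v'\<in>V. ip v' v' = 1 \<and> Q v v = ip v v * Q v' v'" if v: "v \<in> V" "ip v v \<noteq> 0" for v
  proof -
    have pos: "ip v v > 0"
      using HV.nonneg[of v] v by simp
    show ?thesis
      using v pos by (intro bexI[of _ "fscale (1 / sqrt (ip v v)) v"])
        (auto simp: HV.bilinear QV.bilinear)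
  qed
  have ne: "S \<noteq> {}"
    using normalize[OF w] by (auto simp: S_def)
  have bdd: "bdd_below S"
    by (rule bdd_belowI[of _ 0]) (auto simp: S_def QV.nonneg)
  have lower: "\<mu> * ip v v \<le> Q v v" if v: "v \<in> V" for v
  proof (cases "ip v v = 0")
    case True
    then show ?thesis
      using QV.nonneg[OF v] by simp
  next
    case False
    from normalize[OF v False] obtain v' where v': "v' \<in> V" "ip v' v' = 1" "Q v v = ip v v * Q v' v'"
      by blast
    then have "\<mu> \<le> Q v' v'"
      unfolding \<mu>_def by (intro cInf_lower bdd) (auto simp: S_def)
    then have "\<mu> * ip v v \<le> Q v' v' * ip v v"
      using HV.nonneg[OF v] by (rule mult_right_mono)
    then show ?thesis
      using v'(3) by (simp add: mult.commute)
  qed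
  have "\<exists>v\<in>V. ip v v = 1 \<and> Q v v < \<mu> + 1 / real (Suc k)" for k
  proof -
    have "Inf S < \<mu> + 1 / real (Suc k)"
      by (simp add: \<mu>_def)
    from cInf_lessD[OF ne this] show ?thesis
      by (auto simp: S_def)
  qed
  then obtain v where v: "\<And>k. v k \<in> V" "\<And>k. ip (v k) (v k) = 1"
    "\<And>k. Q (v k) (v k) < \<mu> + 1 / real (Suc k)"
    by metis
  have "ip (v k) (v k) + Q (v k) (v k) \<le> \<mu> + 2" for k
  proof -
    have "1 / real (Suc k) \<le> 1"
      by simp
    then show ?thesis
      using v(2,3)[of k] by linarith
  qed
  moreover have "range v \<subseteq> D"
    using v(1) V by auto
  ultimately obtain r where r: "strict_mono r" "form_Cauchy ip (v \<circ> r)"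
    using compact[of v "\<mu> + 2"] by auto
  define u where "u = v \<circ> r"
  have u: "u k \<in> V" "ip (u k) (u k) = 1" for k
    by (simp_all add: u_def v)
  have Qu_lim: "(\<lambda>k. Q (u k) (u k)) \<longlonglongrightarrow> \<mu>"
  proof (rule tendsto_sandwich[OF always_eventually always_eventually tendsto_const])
    show "\<forall>k. \<mu> \<le> Q (u k) (u k)"
      using lower[OF u(1)] u(2) by simp
    show "\<forall>k. Q (u k) (u k) \<le> \<mu> + 1 / real (Suc k)"
    proof
      fix k
      have "1 / real (Suc (r k)) \<le> 1 / real (Suc k)"
        using seq_suble[OF r(1)] by (intro divide_left_mono) auto
      then show "Q (u k) (u k) \<le> \<mu> + 1 / real (Suc k)"
        using v(3)[of "r k"] by (simp add: u_def)
    qed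
    have "(\<lambda>k. \<mu> + 1 / real (Suc k)) \<longlonglongrightarrow> \<mu> + 0"
      by (intro tendsto_intros LIMSEQ_Suc[OF lim_1_over_n])
    then show "(\<lambda>k. \<mu> + 1 / real (Suc k)) \<longlonglongrightarrow> \<mu>" by simp
  qed
  have \<mu>_nonneg: "0 \<le> \<mu>"
    unfolding \<mu>_def by (rule cInf_greatest[OF ne]) (auto simp: S_def QV.nonneg)
  have "form_Cauchy Q u"
    unfolding form_Cauchy_def
  proof (intro allI impI)
    fix e :: real assume e: "e > 0"
    have "eventually (\<lambda>k. Q (u k) (u k) < \<mu> + e / 8) sequentially"
      using Qu_lim e by (intro order_tendstoD) auto
    then obtain K where K: "\<And>k. k \<ge> K \<Longrightarrow> Q (u k) (u k) < \<mu> + e / 8"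
      unfolding eventually_sequentially by blast
    \<comment> \<open>Using \<open>\<mu> + 1\<close> instead of \<open>\<mu>\<close> keeps the
      denominator positive when the infimum is \<open>0\<close>.\<close>
    have "0 < e / (2 * (\<mu> + 1))"
      using e \<mu>_nonneg by simp
    then obtain M where
      M: "\<And>k l. k \<ge> M \<Longrightarrow> l \<ge> M \<Longrightarrow> ip (u k - u l) (u k - u l) < e / (2 * (\<mu> + 1))"
      using r(2) unfolding form_Cauchy_def u_def by metis
    have "Q (u k - u l) (u k - u l) < e" if "k \<ge> max K M" "l \<ge> max K M" for k l
    proof -
      \<comment> \<open>In the parallelogram identity the lower bound for \<open>u k + u l\<close>
        cancels \<open>4 * \<mu>\<close>. What remains is less than \<open>4 * (e / 8)\<close> plus
        \<open>\<mu>\<close> times the \<open>ip\<close>-distance squared, which is at most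
        \<open>e / 2\<close>.\<close>
      have QP: "Q (u k - u l) (u k - u l) = 2 * Q (u k) (u k) + 2 * Q (u l) (u l) - Q (u k + u l) (u k + u l)"
        using u by (simp add: QV.bilinear)
      have HP: "ip (u k + u l) (u k + u l) = 4 - ip (u k - u l) (u k - u l)"
        using u by (simp add: HV.bilinear)
      have "\<mu> * (4 - ip (u k - u l) (u k - u l)) \<le> Q (u k + u l) (u k + u l)"
        using lower[of "u k + u l"] u(1) HP by simp
      moreover have "\<mu> * ip (u k - u l) (u k - u l) \<le> e / 2"
      proof -
        have "\<mu> * ip (u k - u l) (u k - u l) \<le> (\<mu> + 1) * (e / (2 * (\<mu> + 1)))"
          using M[of k l] that \<mu>_nonneg HV.nonneg[of "u k - u l"] u(1)
          by (intro mult_mono) auto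
        also have "\<dots> = e / 2"
          using \<mu>_nonneg by (simp add: field_simps)
        finally show ?thesis .
      qed
      ultimately show ?thesis
        using QP K[of k] K[of l] that by (simp add: algebra_simps)
    qed
    then show "\<exists>K. \<forall>k\<ge>K. \<forall>l\<ge>K. Q (u k - u l) (u k - u l) < e"
      by blast
  qed
  moreover have "range u \<subseteq> D"
    using u(1) V by auto
  ultimately obtain l where l: "l \<in> D" and
    lim: "(\<lambda>k. ip (u k - l) (u k - l)) \<longlonglongrightarrow> 0" "(\<lambda>k. Q (u k - l) (u k - l)) \<longlonglongrightarrow> 0"
    using limit[of u] r(2) unfolding u_def[symmetric] by blast
  have "l \<in> V"
    using closed[OF _ l lim(1)] u(1) by auto
  moreover have "ip l l = 1"
    using LIMSEQ_unique[OF HV.tendsto_self[OF u(1) \<open>l \<in> V\<close> lim(1)]] u(2) by simp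
  moreover have "Q l l = \<mu>"
    using LIMSEQ_unique[OF QV.tendsto_self[OF u(1) \<open>l \<in> V\<close> lim(2)] Qu_lim] .
  ultimately show ?thesis
    using lower by auto
qed

end

section \<open>Expansions along an orthonormal family of weak eigenfunctions\<close>

locale eigen_family = compact_form D ip Q
  for D :: "('a \<Rightarrow> real) set" and ip Q +
  fixes I :: "nat set" and f :: "nat \<Rightarrow> 'a \<Rightarrow> real" and lam :: "nat \<Rightarrow> real"
  assumes mem: "n \<in> I \<Longrightarrow> f n \<in> D"
    and orthonormal: "n \<in> I \<Longrightarrow> k \<in> I \<Longrightarrow> ip (f n) (f k) = (if n = k then 1 else 0)"
    and eigen: "n \<in> I \<Longrightarrow> v \<in> D \<Longrightarrow> Q v (f n) = lam n * ip v (f n)"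
begin

lemma lam_nonneg: "n \<in> I \<Longrightarrow> 0 \<le> lam n"
  using eigen[OF _ mem] orthonormal[of n n] Q.nonneg[OF mem, of n] by simp

text \<open>The \<open>ip\<close>-orthogonal projection of \<open>v\<close> onto the span of the
  \<open>f n\<close> with \<open>n \<in> I\<close> and \<open>n < N\<close>.\<close>

definition partial :: "('a \<Rightarrow> real) \<Rightarrow> nat \<Rightarrow> 'a \<Rightarrow> real" where
  "partial v N = (\<Sum>n\<in>I \<inter> {..<N}. fscale (ip v (f n)) (f n))"

lemma partial_mem: "partial v N \<in> D"
  unfolding partial_def by (auto intro!: H.sum_mem simp: mem)

lemma ip_sum_eigen:
  assumes "A \<subseteq> I" "finite A" "n \<in> I"
  shows "ip (\<Sum>k\<in>A. fscale (a k) (f k)) (f n) = (if n \<in> A then a n else 0)"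
proof -
  have "ip (\<Sum>k\<in>A. fscale (a k) (f k)) (f n) = (\<Sum>k\<in>A. a k * ip (f k) (f n))"
    using assms mem by (subst H.sum_left) (auto simp: H.scale_left intro!: sum.cong)
  also have "\<dots> = (\<Sum>k\<in>A. if k = n then a n else 0)"
    using assms by (intro sum.cong) (auto simp: orthonormal)
  finally show ?thesis
    using assms by simp
qed

lemma ip_sum_self:
  assumes "A \<subseteq> I" "finite A"
  shows "ip (\<Sum>k\<in>A. fscale (a k) (f k)) (\<Sum>k\<in>A. fscale (a k) (f k)) = (\<Sum>k\<in>A. (a k)\<^sup>2)"
proof -
  let ?s = "\<Sum>k\<in>A. fscale (a k) (f k)"
  have s: "?s \<in> D"
    using assms mem by (auto intro!: H.sum_mem)
  have "ip ?s ?s = (\<Sum>k\<in>A. a k * ip ?s (f k))"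
    using assms mem s by (subst H.sum_right) (auto simp: H.scale_right intro!: sum.cong)
  also have "\<dots> = (\<Sum>k\<in>A. (a k)\<^sup>2)"
    using assms by (intro sum.cong) (auto simp: ip_sum_eigen power2_eq_square subset_iff)
  finally show ?thesis .
qed

text \<open>The eigenvalue equation makes the family orthogonal for \<open>Q\<close> too, with
  \<open>Q (f n) (f n) = lam n\<close>.\<close>

lemma Q_sum_self:
  assumes "A \<subseteq> I" "finite A"
  shows "Q (\<Sum>k\<in>A. fscale (a k) (f k)) (\<Sum>k\<in>A. fscale (a k) (f k)) = (\<Sum>k\<in>A. lam k * (a k)\<^sup>2)"
proof -
  let ?s = "\<Sum>k\<in>A. fscale (a k) (f k)"
  have s: "?s \<in> D"
    using assms mem by (auto intro!: H.sum_mem)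
  have "Q ?s ?s = (\<Sum>k\<in>A. a k * Q ?s (f k))"
    using assms mem s by (subst Q.sum_right) (auto simp: Q.scale_right intro!: sum.cong)
  also have "\<dots> = (\<Sum>k\<in>A. lam k * (a k)\<^sup>2)"
    using assms s by (intro sum.cong) (auto simp: eigen ip_sum_eigen power2_eq_square subset_iff)
  finally show ?thesis .
qed

lemma ip_partial: "v \<in> D \<Longrightarrow> ip v (partial v N) = (\<Sum>n\<in>I \<inter> {..<N}. (ip v (f n))\<^sup>2)"
  unfolding partial_def
  by (subst H.sum_right) (auto simp: mem H.scale_right power2_eq_square intro!: sum.cong)

lemma Q_partial: "v \<in> D \<Longrightarrow> Q v (partial v N) = (\<Sum>n\<in>I \<inter> {..<N}. lam n * (ip v (f n))\<^sup>2)"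
  unfolding partial_def
  by (subst Q.sum_right) (auto simp: mem Q.scale_right eigen power2_eq_square intro!: sum.cong)

lemma ip_rest:
  assumes v: "v \<in> D"
  shows "ip (v - partial v N) (v - partial v N) = ip v v - (\<Sum>n\<in>I \<inter> {..<N}. (ip v (f n))\<^sup>2)"
  using H.sym[OF v partial_mem[of v N]] ip_partial[OF v, of N]
    ip_sum_self[of "I \<inter> {..<N}" "\<lambda>n. ip v (f n)"] v partial_mem[of v N]
  by (simp add: H.bilinear flip: partial_def)

text \<open>Pythagoras for \<open>Q\<close>, parallel to \<open>ip_rest\<close>. Nonnegativity of
  the left-hand side turns both into Bessel inequalities.\<close>

lemma Q_rest:
  assumes v: "v \<in> D"
  shows "Q (v - partial v N) (v - partial v N) = Q v v - (\<Sum>n\<in>I \<inter> {..<N}. lam n * (ip v (f n))\<^sup>2)"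
  using Q.sym[OF v partial_mem[of v N]] Q_partial[OF v, of N]
    Q_sum_self[of "I \<inter> {..<N}" "\<lambda>n. ip v (f n)"] v partial_mem[of v N]
  by (simp add: Q.bilinear flip: partial_def)

text \<open>Squared distances of partial sums are blocks of a series with nonnegative terms and
  bounded partial sums. It serves \<open>ip\<close>, where \<open>a n\<close> is a squared
  coefficient, and \<open>Q\<close>, where \<open>a n\<close> carries the extra factor
  \<open>lam n\<close>.\<close>

lemma form_Cauchy_partial:
  assumes v: "v \<in> D" and B: "semi_inner D B" and a: "\<And>n. n \<in> I \<Longrightarrow> 0 \<le> a n"
    and self: "\<And>A. A \<subseteq> I \<Longrightarrow> finite A \<Longrightarrow>
      B (\<Sum>n\<in>A. fscale (ip v (f n)) (f n)) (\<Sum>n\<in>A. fscale (ip v (f n)) (f n)) = (\<Sum>n\<in>A. a n)"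
    and bound: "\<And>N. (\<Sum>n\<in>I \<inter> {..<N}. a n) \<le> C"
  shows "form_Cauchy B (partial v)"
  unfolding form_Cauchy_def
proof (intro allI impI)
  interpret B: semi_inner D B by fact
  fix e :: real assume e: "e > 0"
  define s where "s N = (\<Sum>n\<in>I \<inter> {..<N}. a n)" for N
  have "mono s"
    unfolding s_def by (intro monoI sum_mono2) (auto simp: a)
  moreover have "0 \<le> s N" for N
    unfolding s_def by (intro sum_nonneg) (auto simp: a)
  ultimately have "convergent s"
    using bound by (intro Bseq_mono_convergent BseqI'[of _ C]) (auto simp: s_def mono_def)
  then have "Cauchy s"
    by (rule convergent_Cauchy)
  then obtain K where K: "\<And>k l. k \<ge> K \<Longrightarrow> l \<ge> K \<Longrightarrow> \<bar>s k - s l\<bar> < e"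
    using e unfolding Cauchy_def dist_real_def by metis
  have diff: "B (partial v l - partial v k) (partial v l - partial v k) = s l - s k" if "k \<le> l" for k l
  proof -
    have eq: "I \<inter> {..<l} = (I \<inter> {..<k}) \<union> (I \<inter> {k..<l})"
      using that by auto
    have "partial v l = partial v k + (\<Sum>n\<in>I \<inter> {k..<l}. fscale (ip v (f n)) (f n))"
      unfolding partial_def eq by (rule sum.union_disjoint) auto
    then have "B (partial v l - partial v k) (partial v l - partial v k) = (\<Sum>n\<in>I \<inter> {k..<l}. a n)"
      by (simp only: add_diff_cancel_left') (subst self, auto)
    moreover have "s l = s k + (\<Sum>n\<in>I \<inter> {k..<l}. a n)"
      unfolding s_def eq by (rule sum.union_disjoint) auto
    ultimately show ?thesis by simp
  qed
  have "B (partial v k - partial v l) (partial v k - partial v l) < e" if kl: "k \<ge> K" "l \<ge> K" for k l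
    using K[OF kl] diff[of k l] diff[of l k] B.diff_swap[OF partial_mem partial_mem, of v k v l]
    by (cases "k \<le> l") auto
  then show "\<exists>K. \<forall>k\<ge>K. \<forall>l\<ge>K. B (partial v k - partial v l) (partial v k - partial v l) < e"
    by blast
qed

text \<open>The Bessel inequalities for \<open>ip\<close> and \<open>Q\<close> make the expansion
  Cauchy for both forms, so completeness places the projection onto the closed span inside the form
  domain.\<close>

lemma projection:
  assumes v: "v \<in> D"
  obtains p where "p \<in> D"
    "(\<lambda>N. ip (partial v N - p) (partial v N - p)) \<longlonglongrightarrow> 0"
    "(\<lambda>N. Q (partial v N - p) (partial v N - p)) \<longlonglongrightarrow> 0"
    "\<And>n. n \<in> I \<Longrightarrow> ip (v - p) (f n) = 0"
proof -
  have "form_Cauchy ip (partial v)"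
  proof (rule form_Cauchy_partial[OF v H.semi_inner_axioms, where C = "ip v v"])
    show "(\<Sum>n\<in>I \<inter> {..<N}. (ip v (f n))\<^sup>2) \<le> ip v v" for N
      using ip_rest[OF v, of N] H.nonneg[of "v - partial v N"] v partial_mem by simp
  qed (simp_all add: ip_sum_self)
  moreover have "form_Cauchy Q (partial v)"
  proof (rule form_Cauchy_partial[OF v Q.semi_inner_axioms, where C = "Q v v"])
    show "(\<Sum>n\<in>I \<inter> {..<N}. lam n * (ip v (f n))\<^sup>2) \<le> Q v v" for N
      using Q_rest[OF v, of N] Q.nonneg[of "v - partial v N"] v partial_mem by simp
  qed (simp_all add: Q_sum_self lam_nonneg)
  moreover have "range (partial v) \<subseteq> D"
    using partial_mem by auto
  ultimately obtain p where p: "p \<in> D"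
    "(\<lambda>N. ip (partial v N - p) (partial v N - p)) \<longlonglongrightarrow> 0"
    "(\<lambda>N. Q (partial v N - p) (partial v N - p)) \<longlonglongrightarrow> 0"
    using limit by blast
  moreover have "ip (v - p) (f n) = 0" if n: "n \<in> I" for n
  proof -
    \<comment> \<open>The cut-off \<open>{..<N}\<close> contains \<open>n\<close> exactly when
      \<open>N > n\<close>; from then on the coefficient is constant.\<close>
    have "eventually (\<lambda>N. ip (partial v N) (f n) = ip v (f n)) sequentially"
      using eventually_gt_at_top[of n]
      by eventually_elim (use n in \<open>auto simp: partial_def ip_sum_eigen\<close>)
    then have "(\<lambda>N. ip (partial v N) (f n)) \<longlonglongrightarrow> ip v (f n)"
      by (rule tendsto_eventually)
    moreover have "(\<lambda>N. ip (partial v N) (f n)) \<longlonglongrightarrow> ip p (f n)"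
      using partial_mem p(1) mem[OF n] p(2) by (rule H.tendsto_left)
    ultimately have "ip v (f n) = ip p (f n)"
      by (rule LIMSEQ_unique)
    then show ?thesis
      using v p(1) mem[OF n] by (simp add: H.diff_left)
  qed
  ultimately show thesis
    using that by blast
qed

text \<open>The Rayleigh quotient is minimized on the orthogonal complement \<open>V\<close> of the
  family, which is nontrivial as it contains the residual of \<open>v\<close>. The resulting
  equation on \<open>V\<close> is then extended to all of \<open>D\<close>.\<close>

lemma new_eigenvector:
  assumes v: "v \<in> D" and not_sum: "\<not> ((\<lambda>n. (ip v (f n))\<^sup>2) has_sum ip v v) I"
  obtains u \<mu> where "u \<in> D" "ip u u = 1" "\<And>n. n \<in> I \<Longrightarrow> ip u (f n) = 0"
    "\<And>g. g \<in> D \<Longrightarrow> Q u g = \<mu> * ip u g"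
proof -
  define V where "V = {v \<in> D. \<forall>n\<in>I. ip v (f n) = 0}"
  have V: "fs.subspace V" "V \<subseteq> D"
    using mem by (auto simp: V_def fs.subspace_def H.zero_left H.bilinear)
  have closed: "l \<in> V" if u: "range u \<subseteq> V" and l: "l \<in> D"
    and lim: "(\<lambda>k. ip (u k - l) (u k - l)) \<longlonglongrightarrow> 0" for u l
  proof -
    have "ip l (f n) = 0" if n: "n \<in> I" for n
    proof -
      have "(\<lambda>k. ip (u k) (f n)) \<longlonglongrightarrow> ip l (f n)"
        using u V(2) by (intro H.tendsto_left l lim mem n) auto
      moreover have "ip (u k) (f n) = 0" for k
        using u n by (auto simp: V_def)
      ultimately show ?thesis
        by (simp add: LIMSEQ_const_iff)
    qed
    with l show ?thesis
      by (simp add: V_def)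
  qed
  obtain w where w: "w \<in> V" "ip w w \<noteq> 0"
  proof -
    obtain p where p: "p \<in> D" "(\<lambda>N. ip (partial v N - p) (partial v N - p)) \<longlonglongrightarrow> 0"
      "\<And>n. n \<in> I \<Longrightarrow> ip (v - p) (f n) = 0"
      using projection[OF v] by blast
    \<comment> \<open>A residual of norm zero would let the expansion converge to \<open>v\<close>
      in norm, and \<open>ip_rest\<close> would turn this into the sum excluded by
      \<open>not_sum\<close>.\<close>
    have "ip (v - p) (v - p) \<noteq> 0"
    proof
      assume 0: "ip (v - p) (v - p) = 0"
      have "(\<lambda>N. ip (v - partial v N) (v - partial v N)) \<longlonglongrightarrow> ip (v - p) (v - p)"
      proof (rule H.tendsto_self)
        have "(v - partial v N) - (v - p) = p - partial v N" for N
          by simp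
        then show "(\<lambda>N. ip ((v - partial v N) - (v - p)) ((v - partial v N) - (v - p))) \<longlonglongrightarrow> 0"
          using p(2) H.diff_swap[OF partial_mem p(1)] by simp
      qed (use v p(1) partial_mem in auto)
      then have "(\<lambda>N. ip v v - (ip v v - (\<Sum>n\<in>I \<inter> {..<N}. (ip v (f n))\<^sup>2))) \<longlonglongrightarrow> ip v v - 0"
        unfolding 0 ip_rest[OF v] by (intro tendsto_diff tendsto_const)
      then have "(\<lambda>N. \<Sum>n\<in>I \<inter> {..<N}. (ip v (f n))\<^sup>2) \<longlonglongrightarrow> ip v v"
        by simp
      moreover have "(\<Sum>n\<in>I \<inter> {..<N}. (ip v (f n))\<^sup>2) = (\<Sum>n<N. if n \<in> I then (ip v (f n))\<^sup>2 else 0)" for N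
        by (simp add: Int_commute sum.inter_restrict[symmetric])
      ultimately have "(\<lambda>n. if n \<in> I then (ip v (f n))\<^sup>2 else 0) sums ip v v"
        by (simp add: sums_def)
      \<comment> \<open>Nonnegative terms make the ordered series an unordered sum; the zeros
        outside \<open>I\<close> can then be dropped.\<close>
      then have "((\<lambda>n. if n \<in> I then (ip v (f n))\<^sup>2 else 0) has_sum ip v v) UNIV"
        by (intro sums_nonneg_imp_has_sum) auto
      also have "?this \<longleftrightarrow> ((\<lambda>n. (ip v (f n))\<^sup>2) has_sum ip v v) I"
        by (rule has_sum_cong_neutral) auto
      finally show False
        using not_sum by simp
    qed
    moreover have "v - p \<in> V"
      using v p(1,3) by (simp add: V_def)
    ultimately show thesis
      using that by blast
  qed
  have "\<exists>u\<in>V. ip u u = 1 \<and> (\<forall>v\<in>V. Q u u * ip v v \<le> Q v v)"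
    by (rule minimizer_exists[OF V _ w]) (rule closed)
  then obtain u where u: "u \<in> V" "ip u u = 1"
    and lower: "\<And>v. v \<in> V \<Longrightarrow> Q u u * ip v v \<le> Q v v"
    by metis
  define \<mu> where "\<mu> = Q u u"
  have uD: "u \<in> D"
    using u(1) V(2) by auto
  define B where "B = (\<lambda>g h. Q g h - \<mu> * ip g h)"
  interpret HV: semi_inner V ip
    using H.semi_inner_axioms V by (rule semi_inner_subspace)
  interpret QV: semi_inner V Q
    using Q.semi_inner_axioms V by (rule semi_inner_subspace)
  interpret B: semi_inner V B
  proof
    show "B f g = B g f" if "f \<in> V" "g \<in> V" for f g
      using that HV.sym[of f g] QV.sym[of f g] by (simp add: B_def)
  qed (use lower V(1) in \<open>auto simp: B_def \<mu>_def HV.bilinear QV.bilinear algebra_simps\<close>)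
  \<comment> \<open>Minimality makes \<open>B\<close> nonnegative on \<open>V\<close>, and
    \<open>B u u = 0\<close>. Cauchy-Schwarz then replaces the usual differentiation of the Rayleigh
    quotient.\<close>
  have BV: "B u g = 0" if "g \<in> V" for g
    using B.Cauchy_Schwarz[OF u(1) that] u by (simp add: B_def \<mu>_def)
  \<comment> \<open>Split \<open>g\<close> into \<open>g - p\<close> in \<open>V\<close> and its
    projection \<open>p\<close>. As \<open>u\<close> is orthogonal to each partial expansion for
    both \<open>ip\<close> and \<open>Q\<close>, it is so to \<open>p\<close>; this is where
    \<open>Q\<close>-convergence of the expansion enters.\<close>
  have "Q u g = \<mu> * ip u g" if g: "g \<in> D" for g
  proof -
    obtain p where p: "p \<in> D" "(\<lambda>N. ip (partial g N - p) (partial g N - p)) \<longlonglongrightarrow> 0"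
      "(\<lambda>N. Q (partial g N - p) (partial g N - p)) \<longlonglongrightarrow> 0"
      "\<And>n. n \<in> I \<Longrightarrow> ip (g - p) (f n) = 0"
      using projection[OF g] by blast
    have "B u (g - p) = 0"
      using g p by (intro BV) (simp add: V_def)
    moreover have orth: "ip u (partial g N) = 0" "Q u (partial g N) = 0" for N
      using u(1) uD unfolding partial_def
      by (subst H.sum_right Q.sum_right;
          auto simp: mem H.scale_right Q.scale_right eigen V_def intro!: sum.neutral)+
    have "ip p u = 0"
      using H.tendsto_left[OF partial_mem p(1) uD p(2)] orth(1) H.sym[OF uD partial_mem]
      by (simp add: LIMSEQ_const_iff)
    moreover have "Q p u = 0"
      using Q.tendsto_left[OF partial_mem p(1) uD p(3)] orth(2) Q.sym[OF uD partial_mem]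
      by (simp add: LIMSEQ_const_iff)
    ultimately show ?thesis
      using g p(1) uD H.sym[OF uD p(1)] Q.sym[OF uD p(1)]
      by (simp add: B_def H.diff_right Q.diff_right)
  qed
  then show thesis
    using that[of u \<mu>] u uD by (auto simp: V_def)
qed

text \<open>Infinitely many orthonormal eigenfunctions for one \<open>\<mu>\<close> would be bounded
  in form norm, yet distinct ones have squared distance \<open>2\<close>, so no subsequence is
  Cauchy.\<close>

lemma finite_eigenvalue: "finite {n \<in> I. lam n = \<mu>}"
proof (rule ccontr)
  assume inf: "infinite {n \<in> I. lam n = \<mu>}"
  define e where "e = enumerate {n \<in> I. lam n = \<mu>}"
  have e: "e k \<in> I" "lam (e k) = \<mu>" for k
    using enumerate_in_set[OF inf, of k] by (auto simp: e_def)
  have inj: "e k = e l \<longleftrightarrow> k = l" for k l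
    using strict_mono_enumerate[OF inf] by (simp add: e_def strict_mono_eq)
  have "ip (f (e k)) (f (e k)) + Q (f (e k)) (f (e k)) \<le> 1 + \<mu>" for k
    using e by (simp add: eigen mem orthonormal)
  moreover have "range (\<lambda>k. f (e k)) \<subseteq> D"
    using e mem by auto
  ultimately obtain r where r: "strict_mono r" "form_Cauchy ip ((\<lambda>k. f (e k)) \<circ> r)"
    using compact[of "\<lambda>k. f (e k)" "1 + \<mu>"] by auto
  then obtain K where K: "\<And>k l. k \<ge> K \<Longrightarrow> l \<ge> K \<Longrightarrow>
      ip (f (e (r k)) - f (e (r l))) (f (e (r k)) - f (e (r l))) < 2"
    unfolding form_Cauchy_def by (force dest: spec[of _ 2])
  have "r K \<noteq> r (Suc K)"
    using r(1) by (simp add: strict_mono_eq)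
  then have "ip (f (e (r K)) - f (e (r (Suc K)))) (f (e (r K)) - f (e (r (Suc K)))) = 2"
    using e inj by (simp add: H.bilinear mem orthonormal)
  with K[of K "Suc K"] show False by simp
qed

end

section \<open>Energy forms on graphs\<close>

text \<open>The ambient function space may be infinite-dimensional. The finite spanning set
  \<open>B\<close> makes a basis of \<open>V\<close> finite, so that the exchange bound applies to
  it.\<close>

lemma independent_card_le_dim:
  assumes "finite B" "V \<subseteq> fs.span B" "A \<subseteq> V" "\<not> fs.dependent A"
  shows "card A \<le> fs.dim V"
proof -
  obtain B' where B': "B' \<subseteq> V" "\<not> fs.dependent B'" "V \<subseteq> fs.span B'" "card B' = fs.dim V"
    by (rule fs.basis_exists)
  have "finite B'"
    using fs.independent_span_bound[of B B'] assms(1,2) B'(1,2) by auto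
  then show ?thesis
    using fs.independent_span_bound[of B' A] assms(3,4) B'(3,4) by auto
qed

lemma l2_eq_wl2: "l2 m = wl2 m"
  by (simp add: l2_def wl2_def mult.commute)

lemma l2_inner_eq_wl2_inner: "l2_inner m = wl2_inner m"
  by (intro ext) (simp add: l2_inner_def wl2_inner_def mult_ac)

text \<open>The discrete gradient on ordered pairs; it turns the edge energy into a weighted square
  norm with weight \<open>b\<close>.\<close>

definition grad :: "('a \<Rightarrow> real) \<Rightarrow> 'a \<times> 'a \<Rightarrow> real" where
  "grad f = (\<lambda>(x, y). f x - f y)"

lemma grad_linear: "grad (f + g) = grad f + grad g" "grad (fscale r f) = fscale r (grad f)"
  by (auto simp: grad_def algebra_simps)

lemma energy_space_eq: "energy_space b c = grad -` wl2 (case_prod b) \<inter> wl2 c"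
  by (auto simp: energy_space_def wl2_def grad_def case_prod_unfold)

lemma energy_form_eq:
  "energy_form b c = (\<lambda>f g. 1 / 2 * wl2_inner (case_prod b) (grad f) (grad g) + wl2_inner c f g)"
  by (intro ext) (simp add: energy_form_def wl2_inner_def grad_def case_prod_unfold)

lemma wl2_inner_nonneg: "(\<And>i. 0 \<le> w i) \<Longrightarrow> 0 \<le> wl2_inner w u u"
  unfolding wl2_inner_self by (intro infsum_nonneg) simp

lemma wl2_inner_zero_weight: "wl2_inner (\<lambda>_. 0) u v = 0"
  by (simp add: wl2_inner_def)

text \<open>The term at \<open>i\<close> is bounded by the whole sum, and its weight is
  positive.\<close>

lemma wl2_inner_tendsto_pointwise:
  assumes w: "\<And>i. 0 \<le> w i" "0 < w i" and u: "\<And>k. u k - l \<in> wl2 w"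
    and lim: "(\<lambda>k. wl2_inner w (u k - l) (u k - l)) \<longlonglongrightarrow> 0"
  shows "(\<lambda>k. u k i) \<longlonglongrightarrow> l i"
proof -
  have "\<bar>u k i - l i\<bar> \<le> sqrt (wl2_inner w (u k - l) (u k - l) / w i)" for k
    using wl2_inner_ge_term[OF w(1) u, of i k] w(2)
    by (intro real_le_rsqrt) (simp add: field_simps)
  moreover have "(\<lambda>k. sqrt (wl2_inner w (u k - l) (u k - l) / w i)) \<longlonglongrightarrow> sqrt (0 / w i)"
    using w(2) by (intro tendsto_intros lim) simp
  ultimately have "(\<lambda>k. u k i - l i) \<longlonglongrightarrow> 0"
    by (intro Lim_null_comparison[of "\<lambda>k. u k i - l i"]) auto
  then show ?thesis
    by (rule LIM_zero_cancel)
qed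

lemma semi_inner_energy:
  assumes "\<And>x y. 0 \<le> b x y" "\<And>x. 0 \<le> c x"
  shows "semi_inner (energy_space b c) (energy_form b c)"
  unfolding energy_space_eq energy_form_eq
  using assms by (intro semi_inner_combine semi_inner_pullback semi_inner_wl2 grad_linear) auto

lemma energy_form_nonneg:
  assumes "\<And>x y. 0 \<le> b x y" "\<And>x. 0 \<le> c x"
  shows "0 \<le> energy_form b c f f"
  unfolding energy_form_eq using assms
  by (intro add_nonneg_nonneg mult_nonneg_nonneg wl2_inner_nonneg) auto

lemma energy_form_zero_le:
  assumes "\<And>x. 0 \<le> c x"
  shows "energy_form b (\<lambda>_. 0) f f \<le> energy_form b c f f"
  using wl2_inner_nonneg[of c f] assms by (simp add: energy_form_eq wl2_inner_zero_weight)

text \<open>Fatou is applied to edge and vertex parts separately: half the edge part and the vertex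
  part are each at most \<open>C\<close>. Hence the factor \<open>2\<close>, harmless because only
  smallness is used later.\<close>

lemma energy_Fatou:
  assumes b: "\<And>x y. 0 \<le> b x y" and c: "\<And>x. 0 \<le> c x" and u: "\<And>k. u k \<in> energy_space b c"
    and bound: "eventually (\<lambda>k. energy_form b c (u k) (u k) \<le> C) sequentially"
    and lim: "\<And>x. (\<lambda>k. u k x) \<longlonglongrightarrow> v x"
  shows "v \<in> energy_space b c" "energy_form b c v v \<le> 2 * C"
proof -
  have "eventually (\<lambda>k. wl2_inner (case_prod b) (grad (u k)) (grad (u k)) \<le> 2 * C) sequentially"
    using bound
  proof eventually_elim
    case (elim k)
    then show ?case
      using wl2_inner_nonneg[of c "u k"] c by (simp add: energy_form_eq)
  qed
  moreover have "(\<lambda>k. grad (u k) p) \<longlonglongrightarrow> grad v p" for p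
    unfolding grad_def case_prod_unfold by (intro tendsto_intros lim)
  ultimately have 1: "grad v \<in> wl2 (case_prod b)" "wl2_inner (case_prod b) (grad v) (grad v) \<le> 2 * C"
    using wl2_Fatou[of "case_prod b" "\<lambda>k. grad (u k)" "2 * C" "grad v"] b u
    by (auto simp: energy_space_eq)
  have "eventually (\<lambda>k. wl2_inner c (u k) (u k) \<le> C) sequentially"
    using bound
  proof eventually_elim
    case (elim k)
    then show ?case
      using wl2_inner_nonneg[of "case_prod b" "grad (u k)"] b by (simp add: energy_form_eq case_prod_unfold)
  qed
  then have 2: "v \<in> wl2 c" "wl2_inner c v v \<le> C"
    using wl2_Fatou[of c u C v] c u lim by (auto simp: energy_space_eq)
  show "v \<in> energy_space b c" "energy_form b c v v \<le> 2 * C"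
    using 1 2 by (simp_all add: energy_space_eq energy_form_eq)
qed

lemma Metric_space_l2:
  assumes m: "\<And>x. 0 < m x"
  shows "Metric_space (l2 m) (l2_dist m)"
proof -
  have m0: "\<And>x. 0 \<le> m x"
    using m by (simp add: less_imp_le)
  interpret semi_inner "l2 m" "l2_inner m"
    unfolding l2_eq_wl2 l2_inner_eq_wl2_inner by (rule semi_inner_wl2) (rule m0)
  have "f = 0" if "f \<in> l2 m" "l2_inner m f f = 0" for f
  proof
    fix x
    show "f x = 0 x"
      using wl2_inner_ge_term[of m f x] m0 that m[of x]
      by (auto simp: l2_eq_wl2 l2_inner_eq_wl2_inner mult_le_0_iff)
  qed
  then have "Metric_space (l2 m) (\<lambda>f g. sqrt (l2_inner m (f - g) (f - g)))"
    using wl2_inner_nonneg[OF m0]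
    by (intro Metric_space_sqrt) (auto simp: l2_inner_eq_wl2_inner wl2_inner_self)
  then show ?thesis
    unfolding l2_dist_def l2_norm_def .
qed

lemma form_dist_eq:
  assumes "\<And>x. 0 \<le> m x"
  shows "form_dist m Q = (\<lambda>f g. sqrt (l2_inner m (f - g) (f - g) + Q (f - g) (f - g)))"
  using wl2_inner_nonneg[OF assms]
  by (intro ext) (simp add: form_dist_def form_norm_def l2_norm_def l2_inner_eq_wl2_inner)

text \<open>Closedness and compact embedding are stated through \<open>Metric_space\<close>
  constants, whose theory becomes available with this fact. Definiteness comes from the
  \<open>l2\<close> part alone.\<close>

lemma Metric_space_form:
  assumes m: "\<And>x. 0 < m x" and b: "\<And>x y. 0 \<le> b x y" and c: "\<And>x. 0 \<le> c x"
    and D: "module.subspace fscale D" "D \<subseteq> l2 m \<inter> energy_space b c"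
  shows "Metric_space D (form_dist m (energy_form b c))"
proof -
  have m0: "\<And>x. 0 \<le> m x"
    using m by (simp add: less_imp_le)
  have H: "semi_inner (l2 m) (l2_inner m)"
    unfolding l2_eq_wl2 l2_inner_eq_wl2_inner by (rule semi_inner_wl2) (rule m0)
  have "semi_inner (l2 m \<inter> energy_space b c) (\<lambda>f g. 1 * l2_inner m f g + energy_form b c f g)"
    by (intro semi_inner_combine H semi_inner_energy b c) simp
  then interpret semi_inner D "\<lambda>f g. 1 * l2_inner m f g + energy_form b c f g"
    by (rule semi_inner_subspace) fact+
  interpret l2: Metric_space "l2 m" "l2_dist m"
    by (rule Metric_space_l2) (rule m)
  have nonneg: "0 \<le> l2_inner m f f" "0 \<le> energy_form b c f f" for f
    using energy_form_nonneg[of b c f] b c wl2_inner_nonneg[of m f] m0 by (auto simp: l2_inner_eq_wl2_inner)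
  have "f = 0" if "f \<in> D" "1 * l2_inner m f f + energy_form b c f f = 0" for f
  proof -
    have "l2_inner m f f = 0"
      using that(2) nonneg[of f] by linarith
    then have "l2_dist m f 0 = 0"
      by (simp add: l2_dist_def l2_norm_def)
    moreover have "0 \<in> D"
      by simp
    ultimately show ?thesis
      using that(1) D(2) l2.zero[of f 0] by auto
  qed
  moreover have "energy_form b c (- f) (- f) = energy_form b c f f" for f
    using grad_linear(2)[of "- 1" f] by (simp add: energy_form_eq wl2_inner_self grad_def case_prod_unfold power2_commute)
  ultimately have "Metric_space D (\<lambda>f g. sqrt (1 * l2_inner m (f - g) (f - g) + energy_form b c (f - g) (f - g)))"
    using nonneg by (intro Metric_space_sqrt) (auto simp: l2_inner_eq_wl2_inner wl2_inner_self)
  then show ?thesis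
    unfolding form_dist_eq[OF m0] by simp
qed

text \<open>Adding \<open>c\<close> enlarges the form, so Cauchy and bounded sequences remain so for
  \<open>Q0\<close>. Closedness of \<open>Q0\<close> supplies a limit, Fatou upgrades the
  convergence to \<open>Q\<close>, and compactness is inherited.\<close>

lemma compact_form_induced:
  assumes m: "\<And>x. 0 < m x" and b: "\<And>x y. 0 \<le> b x y" and c: "\<And>x. 0 \<le> c x"
    and D0: "module.subspace fscale D0" "D0 \<subseteq> l2 m \<inter> energy_space b (\<lambda>_. 0)"
    and closed: "closed_form m (energy_form b (\<lambda>_. 0)) D0"
    and compact: "compactly_embedded m (energy_form b (\<lambda>_. 0)) D0"
  shows "compact_form (induced_domain m D0 c) (l2_inner m) (energy_form b c)"
proof -
  define D where "D = induced_domain m D0 c"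
  define ip where "ip = l2_inner m"
  define Q0 where "Q0 = energy_form b (\<lambda>_. 0)"
  define Q where "Q = energy_form b c"
  have m0: "\<And>x. 0 \<le> m x"
    using m by (simp add: less_imp_le)
  have D_eq: "D = D0 \<inter> energy_space b c"
    using D0(2) by (auto simp: D_def induced_domain_def energy_space_def)
  interpret H: semi_inner "l2 m" ip
    unfolding l2_eq_wl2 ip_def l2_inner_eq_wl2_inner by (rule semi_inner_wl2) (rule m0)
  interpret E: semi_inner "energy_space b c" Q
    unfolding Q_def by (intro semi_inner_energy b c)
  have subD: "fs.subspace D"
    unfolding D_eq using D0(1) E.subspace by (rule fs.subspace_inter)
  have D_sub: "D \<subseteq> l2 m" "D \<subseteq> energy_space b c" "D \<subseteq> D0"
    using D0(2) by (auto simp: D_eq)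
  interpret DH: semi_inner D ip
    using H.semi_inner_axioms subD D_sub(1) by (rule semi_inner_subspace)
  interpret DQ: semi_inner D Q
    using E.semi_inner_axioms subD D_sub(2) by (rule semi_inner_subspace)
  interpret l2: Metric_space "l2 m" "l2_dist m"
    by (rule Metric_space_l2) (rule m)
  interpret M0: Metric_space D0 "form_dist m Q0"
    unfolding Q0_def by (intro Metric_space_form m b D0) simp
  have Q0_le: "Q0 f f \<le> Q f f" for f
    unfolding Q0_def Q_def by (rule energy_form_zero_le) (rule c)
  have Q0_nonneg: "0 \<le> Q0 f f" for f
    unfolding Q0_def by (rule energy_form_nonneg) (simp_all add: b)
  have Q_nonneg: "0 \<le> Q f f" for f
    unfolding Q_def by (rule energy_form_nonneg) (simp_all add: b c)
  have ip_nonneg: "0 \<le> ip f f" for f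
    using wl2_inner_nonneg[of m f] m0 by (simp add: ip_def l2_inner_eq_wl2_inner)
  have dist0: "form_dist m Q0 f g = sqrt (ip (f - g) (f - g) + Q0 (f - g) (f - g))" for f g
    unfolding form_dist_eq[OF m0] ip_def by simp
  have "compact_form D ip Q"
  proof
    fix u assume u: "range u \<subseteq> D" and cau: "form_Cauchy (\<lambda>f g. ip f g + Q f g) u"
    have uD: "u k \<in> D" for k
      using u by auto
    have "M0.MCauchy u"
      unfolding M0.MCauchy_def
    proof (intro conjI allI impI)
      show "range u \<subseteq> D0"
        using u D_sub(3) by auto
      fix e :: real assume "e > 0"
      \<comment> \<open>The threshold is \<open>e\<^sup>2\<close> because \<open>form_dist\<close>
        is a square root while \<open>form_Cauchy\<close> measures squares.\<close>
      then obtain K where K: "\<And>k l. k \<ge> K \<Longrightarrow> l \<ge> K \<Longrightarrow>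
          ip (u k - u l) (u k - u l) + Q (u k - u l) (u k - u l) < e\<^sup>2"
        using cau unfolding form_Cauchy_def by (metis zero_less_power)
      have "form_dist m Q0 (u k) (u l) < e" if "k \<ge> K" "l \<ge> K" for k l
        unfolding dist0
        using K[OF that] Q0_le[of "u k - u l"] \<open>e > 0\<close> by (intro real_less_lsqrt) auto
      then show "\<exists>N. \<forall>n n'. N \<le> n \<longrightarrow> N \<le> n' \<longrightarrow> form_dist m Q0 (u n) (u n') < e"
        by blast
    qed
    then obtain l where "limitin M0.mtopology u l sequentially"
      using closed unfolding closed_form_def Q0_def[symmetric] M0.mcomplete_def by blast
    then have l: "l \<in> D0" and lim0: "\<And>e. e > 0 \<Longrightarrow> \<exists>N. \<forall>n\<ge>N. form_dist m Q0 (u n) l < e"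
      unfolding M0.limit_metric_sequentially by blast+
    have ip_lim: "(\<lambda>k. ip (u k - l) (u k - l)) \<longlonglongrightarrow> 0"
    proof (rule LIMSEQ_I)
      fix e :: real assume "e > 0"
      then obtain N where N: "\<And>n. n \<ge> N \<Longrightarrow> form_dist m Q0 (u n) l < sqrt e"
        using lim0[of "sqrt e"] by auto
      have "norm (ip (u n - l) (u n - l) - 0) < e" if "n \<ge> N" for n
        using N[OF that] Q0_nonneg[of "u n - l"] ip_nonneg[of "u n - l"] by (simp add: dist0)
      then show "\<exists>N. \<forall>n\<ge>N. norm (ip (u n - l) (u n - l) - 0) < e"
        by blast
    qed
    have ul: "u k - l \<in> l2 m" for k
      using uD D_sub(1) l D0(2) by (intro H.mem_intros) auto
    have ptw: "(\<lambda>k. u k x) \<longlonglongrightarrow> l x" for x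
      using wl2_inner_tendsto_pointwise[of m x u l] m0 m ul ip_lim
      by (simp add: l2_eq_wl2 ip_def l2_inner_eq_wl2_inner)
    \<comment> \<open>With \<open>k\<close> fixed, the Cauchy estimate for \<open>u k - u n\<close>
      passes to the pointwise limit in \<open>n\<close>.\<close>
    have Fatou: "u k - l \<in> energy_space b c \<and> Q (u k - l) (u k - l) \<le> 2 * e"
      if K: "\<And>n. n \<ge> K \<Longrightarrow> ip (u k - u n) (u k - u n) + Q (u k - u n) (u k - u n) < e" for k K e
    proof -
      have "u k - u n \<in> energy_space b c" for n
        using uD D_sub(2) by auto
      moreover have "eventually (\<lambda>n. Q (u k - u n) (u k - u n) \<le> e) sequentially"
        using eventually_ge_at_top[of K]
      proof eventually_elim
        case (elim n)
        then show ?case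
          using K[of n] ip_nonneg[of "u k - u n"] by simp
      qed
      moreover have "(\<lambda>n. (u k - u n) x) \<longlonglongrightarrow> (u k - l) x" for x
        by (simp, intro tendsto_intros ptw)
      ultimately show ?thesis
        using energy_Fatou[where b = b and c = c and u = "\<lambda>n. u k - u n" and v = "u k - l" and C = e] b c
        unfolding Q_def by blast
    qed
    have "l \<in> D"
    proof -
      obtain K where "\<And>n. n \<ge> K \<Longrightarrow> ip (u K - u n) (u K - u n) + Q (u K - u n) (u K - u n) < 1"
        using cau unfolding form_Cauchy_def by (metis order_refl zero_less_one)
      then have "u K - l \<in> energy_space b c"
        using Fatou by blast
      moreover have "u K \<in> energy_space b c"
        using uD D_sub(2) by auto
      ultimately have "u K - (u K - l) \<in> energy_space b c"
        by (intro E.mem_intros(3)[of "u K" "u K - l"])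
      then show ?thesis
        using l by (simp add: D_eq)
    qed
    moreover have "(\<lambda>k. Q (u k - l) (u k - l)) \<longlonglongrightarrow> 0"
    proof (rule LIMSEQ_I)
      fix e :: real assume "e > 0"
      \<comment> \<open>The factor \<open>2\<close> from \<open>Fatou\<close> leaves
        \<open>2 * e / 3\<close>, strictly below \<open>e\<close>.\<close>
      then have "e / 3 > 0" by simp
      then obtain K where K: "\<And>k l. k \<ge> K \<Longrightarrow> l \<ge> K \<Longrightarrow>
          ip (u k - u l) (u k - u l) + Q (u k - u l) (u k - u l) < e / 3"
        using cau unfolding form_Cauchy_def by metis
      have "norm (Q (u k - l) (u k - l) - 0) < e" if "k \<ge> K" for k
        using Fatou[of K k "e / 3"] K[OF that] Q_nonneg[of "u k - l"] \<open>e > 0\<close> by auto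
      then show "\<exists>N. \<forall>n\<ge>N. norm (Q (u n - l) (u n - l) - 0) < e"
        by blast
    qed
    ultimately show "\<exists>l\<in>D. (\<lambda>k. ip (u k - l) (u k - l) + Q (u k - l) (u k - l)) \<longlonglongrightarrow> 0"
      using tendsto_add[OF ip_lim, of "\<lambda>k. Q (u k - l) (u k - l)" 0] by auto
  next
    fix u :: "nat \<Rightarrow> 'a \<Rightarrow> real" and C
    assume u: "range u \<subseteq> D" and bound: "\<And>k. ip (u k) (u k) + Q (u k) (u k) \<le> C"
    \<comment> \<open>Boundedness transfers to the metric of \<open>D0\<close> because
      \<open>Q0\<close> is dominated by \<open>Q\<close>.\<close>
    have "range u \<subseteq> M0.mcball 0 (sqrt C)"
    proof safe
      fix k
      have "ip (0 - u k) (0 - u k) + Q0 (0 - u k) (0 - u k) \<le> C"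
        using bound[of k] Q0_le[of "u k"] M0.commute[of 0 "u k"] by (simp add: dist0)
      then show "u k \<in> M0.mcball 0 (sqrt C)"
        using u D_sub(3) fs.subspace_0[OF D0(1)] by (auto simp: dist0)
    qed
    then have "M0.mbounded (range u)"
      unfolding M0.mbounded_def by blast
    then have comp: "compactin l2.mtopology (l2.mtopology closure_of range u)"
      using compact u D_sub(3) unfolding compactly_embedded_def Q0_def[symmetric] by blast
    have ul2: "range u \<subseteq> l2 m"
      using u D_sub(1) by blast
    then have "range u \<subseteq> l2.mtopology closure_of range u"
      by (intro closure_of_subset) simp
    with comp obtain l r where r: "strict_mono r" "limitin l2.mtopology (u \<circ> r) l sequentially"
      unfolding l2.compactin_sequentially by blast
    have "l2.MCauchy (u \<circ> r)"
      using ul2 by (intro l2.convergent_imp_MCauchy[OF _ r(2)]) auto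
    then have cau: "\<And>e. e > 0 \<Longrightarrow> \<exists>N. \<forall>n n'. N \<le> n \<longrightarrow> N \<le> n' \<longrightarrow> l2_dist m ((u \<circ> r) n) ((u \<circ> r) n') < e"
      unfolding l2.MCauchy_def by blast
    have "form_Cauchy ip (u \<circ> r)"
      unfolding form_Cauchy_def
    proof (intro allI impI)
      fix e :: real assume "e > 0"
      then show "\<exists>K. \<forall>k\<ge>K. \<forall>l\<ge>K. ip ((u \<circ> r) k - (u \<circ> r) l) ((u \<circ> r) k - (u \<circ> r) l) < e"
        using cau[of "sqrt e"] by (auto simp: l2_dist_def l2_norm_def ip_def)
    qed
    with r(1) show "\<exists>r. strict_mono r \<and> form_Cauchy ip (u \<circ> r)"
      by blast
  qed
  then show ?thesis
    by (simp add: D_def ip_def Q_def)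
qed

text \<open>Evaluation at a vertex becomes an inner product, the link between Parseval's identity
  and point values.\<close>

lemma l2_inner_indicator: "l2_inner m (\<lambda>y. if y = x then 1 else 0) g = g x * m x"
proof -
  have "l2_inner m (\<lambda>y. if y = x then 1 else 0) g = (\<Sum>\<^sub>\<infinity>y\<in>{x}. g y * m y)"
    unfolding l2_inner_def by (rule infsum_cong_neutral) auto
  then show ?thesis by simp
qed

section \<open>Parseval's identity for the indicator of a vertex\<close>

theorem proposition8:
  fixes b :: "'a::countable \<Rightarrow> 'a \<Rightarrow> real"
    and c m :: "'a \<Rightarrow> real"
    and D0 DL0 DLc :: "('a \<Rightarrow> real) set"
    and L0 Lc :: "('a \<Rightarrow> real) \<Rightarrow> 'a \<Rightarrow> real"
    and lam :: "nat \<Rightarrow> real"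
    and f :: "nat \<Rightarrow> 'a \<Rightarrow> real"
  assumes "\<forall>x. 0 < m x"
    and "graph b (\<lambda>_. 0)"
    and "realization m b D0 DL0 L0"
    and "compactly_embedded m (energy_form b (\<lambda>_. 0)) D0"
    and "\<forall>x. 0 \<le> c x"
    and "induced_realization m b D0 c DLc Lc"
    and "lists_eigenvalues DLc Lc (edim (l2 m)) lam"
    and "orthonormal_on m (indices (edim (l2 m))) f"
    and "\<forall>n \<in> indices (edim (l2 m)). f n \<in> DLc \<and> Lc (f n) = fscale (lam n) (f n)"
  shows "\<forall>x. ((\<lambda>n. \<bar>f n x\<bar>\<^sup>2) has_sum 1 / m x) (indices (edim (l2 m)))"
proof
  fix x
  define I where "I = indices (edim (l2 m))"
  define D where "D = induced_domain m D0 c"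
  define ip where "ip = l2_inner m"
  define Q where "Q = energy_form b c"
  have m0: "\<And>x. 0 \<le> m x"
    using assms(1) by (simp add: less_imp_le)
  have b: "\<And>x y. 0 \<le> b x y"
    using assms(2) by (simp add: graph_def)
  have D0: "fs.subspace D0" "D0 \<subseteq> l2 m \<inter> energy_space b (\<lambda>_. 0)" "finsupp \<subseteq> D0"
    "closed_form m (energy_form b (\<lambda>_. 0)) D0"
    using assms(3) by (auto simp: realization_def)
  interpret compact_form D ip Q
    unfolding D_def ip_def Q_def
    by (rule compact_form_induced) (use assms(1,4,5) b D0 in auto)
  interpret l2: semi_inner "l2 m" ip
    unfolding l2_eq_wl2 ip_def l2_inner_eq_wl2_inner by (rule semi_inner_wl2) (rule m0)
  have D_l2: "D \<subseteq> l2 m"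
    by (auto simp: D_def induced_domain_def)
  have assoc: "DLc \<subseteq> D" "\<And>f g. f \<in> D \<Longrightarrow> g \<in> DLc \<Longrightarrow> Q f g = ip f (Lc g)"
    and sa: "adjoint_domain m DLc Lc = DLc" "Lc ` DLc \<subseteq> l2 m"
    using assms(6)
    by (auto simp: induced_realization_def associated_operator_def self_adjoint_def
        densely_defined_linear_def D_def Q_def ip_def)
  have f: "f n \<in> DLc" "Lc (f n) = fscale (lam n) (f n)" "f n \<in> D" if "n \<in> I" for n
    using assms(9) assoc(1) that by (auto simp: I_def)
  interpret eigen_family D ip Q I f lam
  proof
    show "ip (f n) (f k) = (if n = k then 1 else 0)" if "n \<in> I" "k \<in> I" for n k
      using assms(8) that by (auto simp: orthonormal_on_def I_def ip_def l2_norm_def)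
    show "Q v (f n) = lam n * ip v (f n)" if "n \<in> I" "v \<in> D" for n v
      using assoc(2)[OF that(2) f(1)] f(2,3) that by (simp add: H.scale_right)
  qed (use f in auto)
  define \<delta> :: "'a \<Rightarrow> real" where "\<delta> = (\<lambda>y. if y = x then 1 else 0 :: real)"
  have finsupp_D: "finsupp \<subseteq> D"
  proof
    fix g :: "'a \<Rightarrow> real" assume g: "g \<in> finsupp"
    then have "(\<lambda>x. c x * \<bar>g x\<bar>\<^sup>2) summable_on UNIV"
      by (intro finite_nonzero_values_imp_summable_on) (auto simp: finsupp_def elim: rev_finite_subset)
    with g show "g \<in> D"
      using D0(2,3) by (auto simp: D_def induced_domain_def)
  qed
  have \<delta>_mem: "(\<lambda>z. if z = y then 1 else 0) \<in> D" for y
    using finsupp_D by (auto simp: finsupp_def)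
  have \<delta>: "\<delta> \<in> D"
    using \<delta>_mem by (simp add: \<delta>_def)
  have \<delta>_ip: "ip \<delta> g = g x * m x" for g
    unfolding ip_def \<delta>_def by (rule l2_inner_indicator)
  have "((\<lambda>n. (ip \<delta> (f n))\<^sup>2) has_sum ip \<delta> \<delta>) I"
  proof (rule ccontr)
    assume "\<not> ?thesis"
    then obtain u \<mu> where u: "u \<in> D" "ip u u = 1" "\<And>n. n \<in> I \<Longrightarrow> ip u (f n) = 0"
      and Qu: "\<And>g. g \<in> D \<Longrightarrow> Q u g = \<mu> * ip u g"
      using new_eigenvector[OF \<delta>] by blast
    \<comment> \<open>So far \<open>u\<close> solves the eigenvalue equation only weakly. This
      identity puts it into the adjoint domain, which is \<open>DLc\<close> by
      self-adjointness.\<close>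
    have "ip (Lc g) u = ip g (fscale \<mu> u)" if g: "g \<in> DLc" for g
    proof -
      have "ip (Lc g) u = ip u (Lc g)"
        using g sa(2) u(1) D_l2 by (intro l2.sym) auto
      also have "\<dots> = \<mu> * ip u g"
        using assoc(2)[OF u(1) g] Qu[of g] g assoc(1) by auto
      also have "\<dots> = ip g (fscale \<mu> u)"
        using H.sym[of u g] u(1) g assoc(1) by (simp add: H.scale_right subset_iff)
      finally show ?thesis .
    qed
    then have "u \<in> adjoint_domain m DLc Lc"
      using u(1) D_l2 unfolding adjoint_domain_def ip_def[symmetric] by auto
    with sa(1) have uL: "u \<in> DLc" by simp
    \<comment> \<open>Indicators of vertices belong to \<open>D\<close>, so testing the form against
      them identifies \<open>Lc u\<close> pointwise.\<close>
    have "Lc u = fscale \<mu> u"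
    proof
      fix y :: 'a
      let ?\<delta> = "\<lambda>z. if z = y then 1 else 0 :: real"
      have "Lc u y * m y = Q ?\<delta> u"
        using assoc(2)[OF \<delta>_mem uL] l2_inner_indicator[of m y] by (simp add: ip_def)
      also have "\<dots> = \<mu> * ip ?\<delta> u"
        using Qu[OF \<delta>_mem] Q.sym[OF u(1) \<delta>_mem] H.sym[OF u(1) \<delta>_mem] by simp
      also have "\<dots> = fscale \<mu> u y * m y"
        using l2_inner_indicator[of m y] by (simp add: ip_def)
      finally show "Lc u y = fscale \<mu> u y"
        using assms(1) by (simp add: less_imp_neq[symmetric])
    qed
    define E where "E = eigenspace DLc Lc \<mu>"
    define J where "J = {n \<in> I. lam n = \<mu>}"
    have J: "finite J"
      unfolding J_def by (rule finite_eigenvalue)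
    \<comment> \<open>The listing condition covers every real \<open>\<mu>\<close>, so
      \<open>J\<close> may be empty. Finiteness of \<open>J\<close> rules out the infinite value of
      \<open>edim E\<close> and yields a finite spanning set.\<close>
    have "ecard J = edim E"
      using assms(7) unfolding lists_eigenvalues_def E_def J_def I_def by blast
    with J have "edim E = enat (card J)"
      by (simp add: ecard_def)
    then obtain B where B: "finite B" "E \<subseteq> fs.span B" and dim: "fs.dim E = card J"
      unfolding edim_def by (auto split: if_splits)
    have inj: "inj_on f J"
    proof (rule inj_onI)
      fix n k assume "n \<in> J" "k \<in> J" "f n = f k"
      then show "n = k"
        using orthonormal[of n n] orthonormal[of n k] by (auto simp: J_def split: if_splits)
    qed
    have "u \<notin> f ` J"
      using u(2,3) by (auto simp: J_def)
    \<comment> \<open>With \<open>u\<close> added there is one independent eigenfunction more than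
      the dimension of \<open>E\<close> allows.\<close>
    then have "card (insert u (f ` J)) = Suc (card J)"
      using J inj by (simp add: card_image)
    moreover have "insert u (f ` J) \<subseteq> E"
      using uL \<open>Lc u = fscale \<mu> u\<close> f by (auto simp: E_def J_def eigenspace_def)
    moreover have "\<not> fs.dependent (insert u (f ` J))"
    proof (rule H.independent_orthogonal)
      show "insert u (f ` J) \<subseteq> D"
        using u(1) f by (auto simp: J_def)
      show "ip v v \<noteq> 0" if "v \<in> insert u (f ` J)" for v
        using that u(2) orthonormal by (auto simp: J_def)
      show "ip v w = 0" if "v \<in> insert u (f ` J)" "w \<in> insert u (f ` J)" "v \<noteq> w" for v w
        using that u(3) orthonormal H.sym[OF u(1) f(3)] by (auto simp: J_def)
    qed
    ultimately have "Suc (card J) \<le> fs.dim E"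
      using independent_card_le_dim[OF B, of "insert u (f ` J)"] by simp
    with dim show False by simp
  qed
  \<comment> \<open>Here \<open>ip \<delta> (f n) = f n x * m x\<close> and
    \<open>ip \<delta> \<delta> = m x\<close>; division by \<open>(m x)\<^sup>2\<close> gives the
    claim.\<close>
  then have "((\<lambda>n. (f n x * m x)\<^sup>2) has_sum m x) I"
    by (simp add: \<delta>_ip) (simp add: \<delta>_def)
  then have "((\<lambda>n. (f n x * m x)\<^sup>2 * (1 / (m x)\<^sup>2)) has_sum m x * (1 / (m x)\<^sup>2)) I"
    by (rule has_sum_cmult_left)
  moreover have pos: "m x > 0"
    using assms(1) by simp
  have "(f n x * m x)\<^sup>2 * (1 / (m x)\<^sup>2) = \<bar>f n x\<bar>\<^sup>2" for n
    using pos by (simp add: power_mult_distrib)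
  moreover have "m x * (1 / (m x)\<^sup>2) = 1 / m x"
    using pos by (simp add: power2_eq_square)
  ultimately show "((\<lambda>n. \<bar>f n x\<bar>\<^sup>2) has_sum 1 / m x) (indices (edim (l2 m)))"
    by (simp only: I_def)
qed

end
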